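(* The group $\Gamma=\langle a,b,c\mid aca^{-1}c^{-1},\,b^2,\,(ab)^2\rangle$ does not possess the property AGA.
   Context: $U_\infty$ denotes the direct limit of the unitary groups $U_n$ under the natural inclusions $U_n\to U_{n+1}$ ($u\mapsto u\oplus 1$), with the operator norm; $I\in U_\infty$ is the unit matrix. Let $\Gamma=\langle g_1,\ldots,g_n\mid r_1,\ldots,r_k\rangle$ be a finite presentation; the set of generators is assumed symmetric (with every $g_i$ it contains $g_i^{-1}$) and the set of relations is assumed to contain the relations $g_ig_i^{-1}$ (these additional generators and relations are usually not written). A set of unitaries $\sigma=\{u_1,\ldots,u_n\}\subset U_\infty$, $\sigma(g_i)=u_i$, has deviation $|||\sigma|||=\max_j\|r_j(u_1,\ldots,u_n)-I\|$, where $r_j(u_1,\ldots,u_n)$ is obtained by substituting $u_i$ for $g_i$. It is an $\varepsilon$-almost representation if $|||\sigma|||\le\varepsilon$; $R_\varepsilon(\Gamma)$ is the set of all $\varepsilon$-almost representations. An asymptotic representation is a family $\sigma_t=\{u_1(t),\ldots,u_n(t)\}\subset U_\infty$, $t\in[0,\infty)$, of norm-continuous unitary paths such that $|||\sigma_t|||\to0$ as $t\to\infty$; $R_{asym}(\Gamma)$ is the set of all asymptotic representations. $\Gamma$ has the property AGA if for every $\varepsilon>0$ one can find a number $\delta(\varepsilon)$, with $\delta(\varepsilon)\to0$ as $\varepsilon\to0$, such that for every $\sigma\in R_\varepsilon(\Gamma)$ there exists $\sigma_t\in R_{asym}(\Gamma)$ with $\sigma_0=\sigma$ and $|||\sigma_t|||\le\delta(\varepsilon)$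 for all $t\in[0,\infty)$. This property does not depend on the choice of a finite presentation. *)

theory Defs
  imports Complex_Main
begin

text \<open>Matrices indexed by all pairs of natural numbers. Every series below has only finitely many
  nonzero terms when the matrices and vectors involved come from \<open>U_inf\<close>, differences of
  its elements, and finitely supported vectors.\<close>

type_synonym cmat = "nat \<Rightarrow> nat \<Rightarrow> complex"

definition mat_one :: cmat where
  "mat_one = (\<lambda>i j. if i = j then 1 else 0)"

definition mat_mult :: "cmat \<Rightarrow> cmat \<Rightarrow> cmat" where
  "mat_mult A B = (\<lambda>i j. \<Sum>k. A i k * B k j)"

definition mat_diff :: "cmat \<Rightarrow> cmat \<Rightarrow> cmat" where
  "mat_diff A B = (\<lambda>i j. A i j - B i j)"

definition mat_adj :: "cmat \<Rightarrow> cmat" where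
  "mat_adj A = (\<lambda>i j. cnj (A j i))"

definition mat_apply :: "cmat \<Rightarrow> (nat \<Rightarrow> complex) \<Rightarrow> nat \<Rightarrow> complex" where
  "mat_apply A x = (\<lambda>i. \<Sum>j. A i j * x j)"

definition vec_norm :: "(nat \<Rightarrow> complex) \<Rightarrow> real" where
  "vec_norm x = sqrt (\<Sum>i. (cmod (x i))\<^sup>2)"

text \<open>The operator norm of a finitely supported matrix. It is only applied to differences of
  elements of \<open>U_inf\<close>, for which the supremum is over a nonempty bounded set.\<close>

definition op_norm :: "cmat \<Rightarrow> real" where
  "op_norm A = (SUP x\<in>{x. finite {i. x i \<noteq> 0} \<and> vec_norm x \<le> 1}. vec_norm (mat_apply A x))"

text \<open>\<open>U_fin n\<close> consists of the matrices \<open>u \<oplus> 1 \<oplus> 1 \<oplus> \<dots>\<close> with \<open>u\<close> a unitary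
  \<open>n \<times> n\<close> matrix. In this model the inclusion \<open>u \<mapsto> u \<oplus> 1\<close> of \<open>U_fin n\<close>
  into \<open>U_fin (Suc n)\<close> is set inclusion, and the direct limit is the union.\<close>

definition U_fin :: "nat \<Rightarrow> cmat set" where
  "U_fin n = {u. (\<forall>i j. n \<le> i \<or> n \<le> j \<longrightarrow> u i j = mat_one i j)
           \<and> mat_mult (mat_adj u) u = mat_one \<and> mat_mult u (mat_adj u) = mat_one}"

definition U_inf :: "cmat set" where
  "U_inf = (\<Union>n. U_fin n)"

text \<open>A finite presentation is given by a finite type \<open>'g\<close> of generators and a finite set of
  words. The symmetric generating set is \<open>'g letter\<close>: the formal inverses are generators in their
  own right, sent to unitaries of their own, and are tied to the original generators only through
  the relations \<open>g g\<inverse>\<close> added by \<open>sym_relators\<close>.\<close>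

datatype 'g letter = Gen 'g | Inv 'g

type_synonym 'g word = "'g letter list"

fun letter_inv :: "'g letter \<Rightarrow> 'g letter" where
  "letter_inv (Gen g) = Inv g"
| "letter_inv (Inv g) = Gen g"

definition sym_relators :: "'g word set \<Rightarrow> 'g word set" where
  "sym_relators R = R \<union> range (\<lambda>x. [x, letter_inv x])"

definition word_eval :: "('g letter \<Rightarrow> cmat) \<Rightarrow> 'g word \<Rightarrow> cmat" where
  "word_eval \<sigma> w = foldr (\<lambda>x A. mat_mult (\<sigma> x) A) w mat_one"

definition deviation :: "('g::finite) word set \<Rightarrow> ('g letter \<Rightarrow> cmat) \<Rightarrow> real" where
  "deviation R \<sigma> = Max ((\<lambda>r. op_norm (mat_diff (word_eval \<sigma> r) mat_one)) ` sym_relators R)"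

definition almost_reps :: "('g::finite) word set \<Rightarrow> real \<Rightarrow> ('g letter \<Rightarrow> cmat) set" where
  "almost_reps R \<epsilon> = {\<sigma>. (\<forall>x. \<sigma> x \<in> U_inf) \<and> deviation R \<sigma> \<le> \<epsilon>}"

definition norm_continuous_path :: "(real \<Rightarrow> cmat) \<Rightarrow> bool" where
  "norm_continuous_path u \<longleftrightarrow>
     (\<forall>s\<ge>0. ((\<lambda>t. op_norm (mat_diff (u t) (u s))) \<longlongrightarrow> 0) (at s within {0..}))"

definition asym_reps :: "('g::finite) word set \<Rightarrow> (real \<Rightarrow> 'g letter \<Rightarrow> cmat) set" where
  "asym_reps R = {\<sigma>. (\<forall>t\<ge>0. \<forall>x. \<sigma> t x \<in> U_inf)
                   \<and> (\<forall>x. norm_continuous_path (\<lambda>t. \<sigma> t x))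
                   \<and> ((\<lambda>t. deviation R (\<sigma> t)) \<longlongrightarrow> 0) at_top}"

text \<open>The property of a group presented by \<open>R\<close>, expressed through the chosen finite
  presentation.\<close>

definition AGA :: "('g::finite) word set \<Rightarrow> bool" where
  "AGA R \<longleftrightarrow> (\<exists>\<delta>::real \<Rightarrow> real. (\<delta> \<longlongrightarrow> 0) (at_right 0) \<and>
     (\<forall>\<epsilon>>0. \<forall>\<sigma>\<in>almost_reps R \<epsilon>. \<exists>\<tau>\<in>asym_reps R.
        \<tau> 0 = \<sigma> \<and> (\<forall>t\<ge>0. deviation R (\<tau> t) \<le> \<delta> \<epsilon>)))"

datatype gen = gen_a | gen_b | gen_c

instance gen :: finite
proof
  have "(UNIV :: gen set) = {gen_a, gen_b, gen_c}"
    using gen.exhaust by auto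
  then show "finite (UNIV :: gen set)"
    by (metis finite.emptyI finite.insertI)
qed

definition Gamma_relators :: "gen word set" where
  "Gamma_relators =
     {[Gen gen_a, Gen gen_c, Inv gen_a, Inv gen_c],
      [Gen gen_b, Gen gen_b],
      [Gen gen_a, Gen gen_b, Gen gen_a, Gen gen_b]}"

end

theory Submission
  imports
    Defs
    "HOL-Complex_Analysis.Complex_Analysis"
    "Jordan_Normal_Form.Spectral_Radius"
begin

text \<open>
  In \<open>\<Gamma>\<close> the elements \<open>a\<close> and \<open>c\<close> commute, while \<open>b\<close> and \<open>ab\<close> are involutions, so
  \<open>a = (ab) b\<close> is a product of two reflections. Two integer quantities attached to an almost
  representation cannot change along a path of almost representations, and together they are
  incompatible with an arbitrarily small deviation.

  The first is the Bott index of the almost commuting pair \<open>(a, c)\<close>: the winding number around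
  \<open>0\<close> of the closed curve \<open>s \<mapsto> det ((1 - s) ca + s ac)\<close>. It is stable under small perturbations
  (\<open>bott_stable\<close>). The second is the number of eigenvalues near \<open>-1\<close> of the almost involutions
  \<open>b\<close> and \<open>ab\<close> (\<open>near_one_off_stable\<close>).

  The starting point is the pair of Voiculescu: for large \<open>n\<close> let \<open>a\<close> be the diagonal matrix of the
  \<open>n\<close>-th roots of unity, \<open>c\<close> the cyclic shift and \<open>b\<close> the inversion of \<open>\<int>/n\<close>. Only the relation
  \<open>ac = ca\<close> is violated, by \<open>2\<pi>/n\<close> at most, and the Bott index is \<open>1\<close>. Suppose that it is joined to
  almost representations of vanishing deviation by a path of small deviation. Since \<open>b\<close> and \<open>ab\<close>
  differ from \<open>1\<close> only on \<open>n\<close> coordinates at the start, they have at most \<open>n\<close> eigenvalues near \<open>-1\<close>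
  at all times, however large the matrices become. Late on the path \<open>b\<close> and \<open>ab\<close> are
  close to exact reflections (\<open>almost_involution_correction\<close>), hence \<open>a\<close> is close to a unitary \<open>a'\<close>
  for which \<open>a' - 1\<close> has rank at most \<open>2n\<close>. Then \<open>det (1 + s ((ca')\<^sup>* a'c - 1))\<close> is a product of at
  most \<open>4n\<close> factors different from \<open>1\<close>, and these approach \<open>1\<close> as the deviation tends to \<open>0\<close>.
  As \<open>n\<close> is fixed, the determinant finally stays in the right half plane and the Bott index is
  \<open>0\<close> (\<open>bott_eq_0_of_reflections\<close>), a contradiction.

  The path is continuous for the operator norm only, so its matrices need not have bounded size, even
  on compact intervals of time. Stability is therefore stated for two matrices of a
  common size \<open>N\<close> with constants independent of \<open>N\<close>, and the invariants at different times are
  compared in all sufficiently large sizes (\<open>obstructed_along_path\<close>).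
\<close>

section \<open>Unitary matrices and operator norm bounds\<close>

unbundle no inner_syntax
unbundle no vec_syntax
no_notation fps_nth (infixl "$" 75)
hide_const (open) Finite_Cartesian_Product.vec Finite_Cartesian_Product.row
  Determinants.det Finite_Cartesian_Product.mat

definition adj :: "complex mat \<Rightarrow> complex mat" where
  "adj A = mat (dim_col A) (dim_row A) (\<lambda>(i, j). cnj (A $$ (j, i)))"

definition unitary_mat :: "nat \<Rightarrow> complex mat \<Rightarrow> bool" where
  "unitary_mat N U \<longleftrightarrow> U \<in> carrier_mat N N \<and> adj U * U = 1\<^sub>m N"

definition vnorm :: "complex vec \<Rightarrow> real" where
  "vnorm v = L2_set (\<lambda>i. cmod (v $ i)) {..<dim_vec v}"

definition opbound :: "nat \<Rightarrow> complex mat \<Rightarrow> real \<Rightarrow> bool" where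
  "opbound N A C \<longleftrightarrow> (\<forall>v\<in>carrier_vec N. vnorm (A *\<^sub>v v) \<le> C * vnorm v)"

lemma square_mat_simps [simp]:
  fixes A B :: "complex mat"
  assumes "A \<in> carrier_mat n n"
  shows "B \<in> carrier_mat n n \<Longrightarrow> A * B \<in> carrier_mat n n" "A * 1\<^sub>m n = A" "1\<^sub>m n * A = A"
  using assms right_mult_one_mat[OF assms] left_mult_one_mat[OF assms] by auto

lemma square_mat_vec_carrier [simp]:
  fixes A :: "complex mat"
  shows "A \<in> carrier_mat n n \<Longrightarrow> v \<in> carrier_vec n \<Longrightarrow> A *\<^sub>v v \<in> carrier_vec n"
  by simp

declare minus_carrier_mat [simp]

lemma square_mat_assoc:
  fixes A B C :: "complex mat"
  assumes "A \<in> carrier_mat n n" "B \<in> carrier_mat n n" "C \<in> carrier_mat n n"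
  shows "(A * B) * C = A * (B * C)"
  using assms by (rule assoc_mult_mat)

lemma adj_carrier [simp]: "A \<in> carrier_mat n m \<Longrightarrow> adj A \<in> carrier_mat m n"
  by (auto simp: adj_def)

lemma adj_dim [simp]: "dim_row (adj A) = dim_col A" "dim_col (adj A) = dim_row A"
  by (simp_all add: adj_def)

lemma adj_adj [simp]: "adj (adj A) = A"
  by (rule eq_matI) (auto simp: adj_def)

lemma index_mat_mult_sum:
  assumes "A \<in> carrier_mat n m" "B \<in> carrier_mat m k" "i < n" "j < k"
  shows "(A * B) $$ (i, j) = (\<Sum>l<m. A $$ (i, l) * B $$ (l, j))"
  using assms by (auto simp: scalar_prod_def lessThan_atLeast0 intro!: sum.cong)

lemma index_mult_mat_vec_sum:
  assumes "A \<in> carrier_mat n m" "v \<in> carrier_vec m" "i < n"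
  shows "(A *\<^sub>v v) $ i = (\<Sum>l<m. A $$ (i, l) * v $ l)"
  using assms by (auto simp: scalar_prod_def lessThan_atLeast0 intro!: sum.cong)

lemma adj_mult:
  assumes A: "A \<in> carrier_mat n m" and B: "B \<in> carrier_mat m k"
  shows "adj (A * B) = adj B * adj A"
proof (rule eq_matI)
  fix i j assume "i < dim_row (adj B * adj A)" "j < dim_col (adj B * adj A)"
  then have ij: "i < k" "j < n" using A B by (auto simp: adj_def)
  have "adj (A * B) $$ (i, j) = cnj ((A * B) $$ (j, i))"
    using A B ij by (simp add: adj_def)
  also have "\<dots> = (\<Sum>l<m. adj B $$ (i, l) * adj A $$ (l, j))"
    using A B ij by (subst index_mat_mult_sum[OF A B]) (auto simp: adj_def intro!: sum.cong)
  also have "\<dots> = (adj B * adj A) $$ (i, j)"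
    using A B ij by (subst index_mat_mult_sum[where m = m]) auto
  finally show "adj (A * B) $$ (i, j) = (adj B * adj A) $$ (i, j)" .
qed (use A B in \<open>auto simp: adj_def\<close>)

lemma unitary_mat_carrier: "unitary_mat N U \<Longrightarrow> U \<in> carrier_mat N N"
  by (simp add: unitary_mat_def)

lemma unitary_mat_one: "unitary_mat N (1\<^sub>m N)"
proof -
  have "adj (1\<^sub>m N) = 1\<^sub>m N" by (rule eq_matI) (auto simp: adj_def)
  then show ?thesis by (simp add: unitary_mat_def)
qed

lemma unitary_mat_left: "unitary_mat N U \<Longrightarrow> adj U * U = 1\<^sub>m N"
  by (simp add: unitary_mat_def)

lemma unitary_mat_right: "unitary_mat N U \<Longrightarrow> U * adj U = 1\<^sub>m N"
  unfolding unitary_mat_def by (metis adj_carrier mat_mult_left_right_inverse)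

lemma unitary_mat_adj: "unitary_mat N U \<Longrightarrow> unitary_mat N (adj U)"
  using unitary_mat_right[of N U] unitary_mat_carrier[of N U]
  by (simp add: unitary_mat_def)

lemma unitary_mat_mult:
  assumes U: "unitary_mat N U" and V: "unitary_mat N V"
  shows "unitary_mat N (U * V)"
proof -
  note c = unitary_mat_carrier[OF U] unitary_mat_carrier[OF V]
  have "adj (U * V) * (U * V) = adj V * (adj U * U) * V"
    using c by (simp add: adj_mult[OF c] square_mat_assoc[of _ N])
  also have "\<dots> = 1\<^sub>m N"
    using c by (simp add: unitary_mat_left[OF U] unitary_mat_left[OF V])
  finally show ?thesis using c by (simp add: unitary_mat_def)
qed

lemma vnorm_nonneg [simp]: "0 \<le> vnorm v"
  by (simp add: vnorm_def)

lemma vnorm_zero [simp]: "vnorm (0\<^sub>v n) = 0"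
  by (simp add: vnorm_def L2_set_def)

lemma vnorm_eq_0: "v \<in> carrier_vec n \<Longrightarrow> vnorm v = 0 \<longleftrightarrow> v = 0\<^sub>v n"
  by (auto simp: vnorm_def L2_set_eq_0_iff)

lemma vnorm_pos: "v \<in> carrier_vec n \<Longrightarrow> v \<noteq> 0\<^sub>v n \<Longrightarrow> 0 < vnorm v"
  using vnorm_eq_0[of v n] vnorm_nonneg[of v] by linarith

lemma vnorm_add: "v \<in> carrier_vec n \<Longrightarrow> w \<in> carrier_vec n \<Longrightarrow> vnorm (v + w) \<le> vnorm v + vnorm w"
proof -
  assume v: "v \<in> carrier_vec n" and w: "w \<in> carrier_vec n"
  have "vnorm (v + w) = L2_set (\<lambda>i. cmod (v $ i + w $ i)) {..<n}"
    using v w unfolding vnorm_def by (intro L2_set_cong) auto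
  also have "\<dots> \<le> L2_set (\<lambda>i. cmod (v $ i) + cmod (w $ i)) {..<n}"
    by (intro L2_set_mono) (auto simp: norm_triangle_ineq)
  also have "\<dots> \<le> L2_set (\<lambda>i. cmod (v $ i)) {..<n} + L2_set (\<lambda>i. cmod (w $ i)) {..<n}"
    by (rule L2_set_triangle_ineq)
  finally show ?thesis using v w by (simp add: vnorm_def)
qed

lemma vnorm_smult: "vnorm (c \<cdot>\<^sub>v v) = cmod c * vnorm v"
proof -
  have "vnorm (c \<cdot>\<^sub>v v) = L2_set (\<lambda>i. cmod c * cmod (v $ i)) {..<dim_vec v}"
    unfolding vnorm_def by (intro L2_set_cong) (auto simp: norm_mult)
  then show ?thesis by (simp add: vnorm_def L2_set_right_distrib)
qed

lemma vnorm_uminus: "vnorm (- v) = vnorm v"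
  unfolding vnorm_def by (intro L2_set_cong) auto

lemma vnorm_pointwise:
  assumes v: "v \<in> carrier_vec n" and w: "w \<in> carrier_vec n" and C: "0 \<le> C"
    and le: "\<And>i. i < n \<Longrightarrow> cmod (v $ i) \<le> C * cmod (w $ i)"
  shows "vnorm v \<le> C * vnorm w"
proof -
  have "vnorm v \<le> L2_set (\<lambda>i. C * cmod (w $ i)) {..<n}"
    using v le unfolding vnorm_def by (auto intro!: L2_set_mono)
  then show ?thesis using w C by (simp add: vnorm_def L2_set_right_distrib)
qed

lemma vnorm_sq: "of_real ((vnorm v)\<^sup>2) = v \<bullet>c v"
proof -
  have "(vnorm v)\<^sup>2 = (\<Sum>i<dim_vec v. (cmod (v $ i))\<^sup>2)"
    by (simp add: vnorm_def L2_set_def sum_nonneg)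
  then show ?thesis
    by (auto simp: scalar_prod_def lessThan_atLeast0 complex_norm_square[symmetric] conjugate_complex_def intro!: sum.cong)
qed

lemma cscalar_prod_adj:
  assumes A: "A \<in> carrier_mat n m" and v: "v \<in> carrier_vec m" and w: "w \<in> carrier_vec n"
  shows "(A *\<^sub>v v) \<bullet>c w = v \<bullet>c (adj A *\<^sub>v w)"
proof -
  have "(A *\<^sub>v v) \<bullet>c w = (\<Sum>i<n. (\<Sum>j<m. A $$ (i, j) * v $ j) * cnj (w $ i))"
    using A v w by (auto simp: scalar_prod_def lessThan_atLeast0 conjugate_complex_def intro!: sum.cong)
  also have "\<dots> = (\<Sum>j<m. \<Sum>i<n. A $$ (i, j) * v $ j * cnj (w $ i))"
    by (simp add: sum_distrib_right sum.swap[of _ "{..<m}" "{..<n}"])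
  also have "\<dots> = (\<Sum>j<m. v $ j * cnj (\<Sum>i<n. cnj (A $$ (i, j)) * w $ i))"
    by (simp add: sum_distrib_left mult_ac)
  also have "\<dots> = v \<bullet>c (adj A *\<^sub>v w)"
    using A v w by (auto simp: adj_def scalar_prod_def lessThan_atLeast0 conjugate_complex_def intro!: sum.cong)
  finally show ?thesis .
qed

lemma unitary_cancel:
  assumes "unitary_mat N U" "v \<in> carrier_vec N"
  shows "adj U *\<^sub>v (U *\<^sub>v v) = v" "U *\<^sub>v (adj U *\<^sub>v v) = v"
  using assms unitary_mat_carrier[OF assms(1)]
  by (simp_all add: assoc_mult_mat_vec[symmetric, of _ N N _ N] unitary_mat_left unitary_mat_right)

lemma cscalar_prod_unitary:
  assumes U: "unitary_mat N U" and v: "v \<in> carrier_vec N" and w: "w \<in> carrier_vec N"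
  shows "(U *\<^sub>v v) \<bullet>c (U *\<^sub>v w) = v \<bullet>c w"
  using cscalar_prod_adj[OF unitary_mat_carrier[OF U] v, of "U *\<^sub>v w"] unitary_cancel[OF U w]
    unitary_mat_carrier[OF U] w by simp

lemma vnorm_unitary:
  assumes U: "unitary_mat N U" and v: "v \<in> carrier_vec N"
  shows "vnorm (U *\<^sub>v v) = vnorm v"
proof -
  have "complex_of_real ((vnorm (U *\<^sub>v v))\<^sup>2) = of_real ((vnorm v)\<^sup>2)"
    by (simp only: vnorm_sq cscalar_prod_unitary[OF U v v])
  then show ?thesis by (metis of_real_eq_iff power2_eq_iff_nonneg vnorm_nonneg)
qed

lemma opbound_mono: "opbound N A C \<Longrightarrow> C \<le> D \<Longrightarrow> opbound N A D"
  unfolding opbound_def by (meson mult_right_mono order_trans vnorm_nonneg)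

lemma opbound_add:
  assumes "opbound N A C" "opbound N B D" "A \<in> carrier_mat N N" "B \<in> carrier_mat N N"
  shows "opbound N (A + B) (C + D)"
  unfolding opbound_def
proof
  fix v :: "complex vec" assume v: "v \<in> carrier_vec N"
  have "vnorm ((A + B) *\<^sub>v v) \<le> vnorm (A *\<^sub>v v) + vnorm (B *\<^sub>v v)"
    using assms v by (simp add: add_mult_distrib_mat_vec[of _ N N] vnorm_add[of _ N])
  also have "\<dots> \<le> C * vnorm v + D * vnorm v"
    using assms v unfolding opbound_def by (intro add_mono) auto
  finally show "vnorm ((A + B) *\<^sub>v v) \<le> (C + D) * vnorm v" by (simp add: algebra_simps)
qed

lemma opbound_smult:
  assumes "opbound N A C" "A \<in> carrier_mat N N"
  shows "opbound N (c \<cdot>\<^sub>m A) (cmod c * C)"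
  unfolding opbound_def
proof
  fix v :: "complex vec" assume v: "v \<in> carrier_vec N"
  have "(c \<cdot>\<^sub>m A) *\<^sub>v v = c \<cdot>\<^sub>v (A *\<^sub>v v)"
    using assms v by (intro eq_vecI) (auto simp: scalar_prod_def sum_distrib_left mult_ac)
  then show "vnorm ((c \<cdot>\<^sub>m A) *\<^sub>v v) \<le> cmod c * C * vnorm v"
    using assms v by (auto simp: vnorm_smult opbound_def mult.assoc intro!: mult_left_mono)
qed

lemma minus_mat_eq: "A \<in> carrier_mat N N \<Longrightarrow> B \<in> carrier_mat N N \<Longrightarrow> A - B = A + (-1) \<cdot>\<^sub>m (B :: complex mat)"
  by (intro eq_matI) auto

lemma opbound_minus:
  assumes "opbound N A C" "opbound N B D" "A \<in> carrier_mat N N" "B \<in> carrier_mat N N"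
  shows "opbound N (A - B) (C + D)"
  using opbound_add[OF assms(1) opbound_smult[OF assms(2,4), of "-1"]] assms
  by (simp add: minus_mat_eq)

lemma opbound_minus_commute:
  assumes "opbound N (A - B) C" "A \<in> carrier_mat N N" "B \<in> carrier_mat N N"
  shows "opbound N (B - A) C"
proof -
  have "B - A = (-1) \<cdot>\<^sub>m (A - B)" using assms by (intro eq_matI) auto
  then show ?thesis
    using opbound_smult[OF assms(1), of "-1"] assms minus_carrier_mat[OF assms(3), of A] by simp
qed

lemma opbound_mult:
  assumes "opbound N A C" "opbound N B D" "A \<in> carrier_mat N N" "B \<in> carrier_mat N N" "0 \<le> C"
  shows "opbound N (A * B) (C * D)"
  unfolding opbound_def
proof
  fix v :: "complex vec" assume v: "v \<in> carrier_vec N"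
  have "vnorm (A *\<^sub>v (B *\<^sub>v v)) \<le> C * vnorm (B *\<^sub>v v)"
    using assms v unfolding opbound_def by auto
  also have "\<dots> \<le> C * (D * vnorm v)"
    using assms v unfolding opbound_def by (intro mult_left_mono) auto
  finally show "vnorm (A * B *\<^sub>v v) \<le> C * D * vnorm v"
    using assms v by (simp add: assoc_mult_mat_vec[of _ N N _ N] mult.assoc)
qed

lemma opbound_unitary: "unitary_mat N U \<Longrightarrow> opbound N U 1"
  by (simp add: opbound_def vnorm_unitary)

lemma opbound_unitary_mult_left:
  assumes "unitary_mat N U" "opbound N A C" "A \<in> carrier_mat N N"
  shows "opbound N (U * A) C"
  using opbound_mult[OF opbound_unitary[OF assms(1)] assms(2) unitary_mat_carrier[OF assms(1)] assms(3)]
  by simp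

lemma opbound_unitary_mult_right:
  assumes "unitary_mat N U" "opbound N A C" "A \<in> carrier_mat N N" "0 \<le> C"
  shows "opbound N (A * U) C"
  using opbound_mult[OF assms(2) opbound_unitary[OF assms(1)] assms(3) unitary_mat_carrier[OF assms(1)] assms(4)]
  by simp

lemma opbound_self_minus:
  assumes "A \<in> carrier_mat N N" "0 \<le> C"
  shows "opbound N (A - A) C"
proof -
  have "0\<^sub>m N N *\<^sub>v v = 0\<^sub>v N" if "v \<in> carrier_vec N" for v :: "complex vec"
    using that by (intro eq_vecI) (auto simp: scalar_prod_def)
  then show ?thesis using assms by (auto simp: opbound_def)
qed

text \<open>A vector annihilated by \<open>A\<close> is moved by \<open>A - U\<close> by its full length.\<close>

lemma det_nonzero_near_unitary:
  assumes U: "unitary_mat N U" and A: "A \<in> carrier_mat N N" and C: "opbound N (A - U) C" "C < 1"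
  shows "det A \<noteq> 0"
proof
  assume "det A = 0"
  then obtain v where v: "v \<in> carrier_vec N" "v \<noteq> 0\<^sub>v N" "A *\<^sub>v v = 0\<^sub>v N"
    using det_0_iff_vec_prod_zero[OF A] by blast
  note Uc = unitary_mat_carrier[OF U]
  have "(A - U) *\<^sub>v v = A *\<^sub>v v - U *\<^sub>v v"
    using A Uc v by (simp add: minus_mult_distrib_mat_vec)
  then have "(A - U) *\<^sub>v v = - (U *\<^sub>v v)"
    using v Uc by auto
  then have "vnorm v \<le> C * vnorm v"
    using C(1) v vnorm_unitary[OF U v(1)] by (auto simp: opbound_def vnorm_uminus dest!: bspec)
  then show False using vnorm_pos[OF v(1,2)] C(2) by simp
qed

section \<open>Orthonormal systems and diagonalization of unitary matrices\<close>

text \<open>Completed by zero rows, fewer than \<open>N\<close> equations in \<open>N\<close> unknowns form a square matrix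
  whose transpose annihilates a unit vector, so it is singular. The equations use the bilinear
  product, without conjugation, so that they pull back along a matrix through its transpose.\<close>

lemma exists_orthogonal_vector:
  fixes G :: "complex vec set"
  assumes G: "finite G" "G \<subseteq> carrier_vec N" and less: "card G < N"
  shows "\<exists>z\<in>carrier_vec N. z \<noteq> 0\<^sub>v N \<and> (\<forall>g\<in>G. g \<bullet> z = 0)"
proof -
  obtain xs where xs: "set xs = G" "distinct xs" using finite_distinct_list[OF G(1)] by blast
  define k where "k = length xs"
  have k: "k < N" using less xs distinct_card[of xs] by (simp add: k_def)
  define A where "A = mat N N (\<lambda>(i, j). if i < k then (xs ! i) $ j else 0)"
  have A: "A \<in> carrier_mat N N" by (simp add: A_def)
  have "A\<^sup>T *\<^sub>v unit_vec N k = 0\<^sub>v N"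
    using k A by (intro eq_vecI) (auto simp: A_def)
  moreover have "unit_vec N k \<noteq> (0\<^sub>v N :: complex vec)"
    using k by (metis index_unit_vec(1) index_zero_vec(1) zero_neq_one)
  ultimately have "det A\<^sup>T = 0"
    using det_0_iff_vec_prod_zero[of "A\<^sup>T" N] A by (auto intro!: exI[of _ "unit_vec N k"])
  then obtain z where z: "z \<in> carrier_vec N" "z \<noteq> 0\<^sub>v N" "A *\<^sub>v z = 0\<^sub>v N"
    using det_0_iff_vec_prod_zero[OF A] det_transpose[OF A] by auto
  have "g \<bullet> z = 0" if "g \<in> G" for g
  proof -
    obtain i where i: "i < k" "g = xs ! i" using \<open>g \<in> G\<close> xs by (metis in_set_conv_nth k_def)
    have gc: "g \<in> carrier_vec N" using that G by auto
    have "row A i = g" using i k gc by (intro eq_vecI) (auto simp: A_def)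
    then have "(A *\<^sub>v z) $ i = g \<bullet> z" using i k A by (simp add: A_def)
    then show ?thesis using z i k by simp
  qed
  then show ?thesis using z by blast
qed

definition orthonormal :: "nat \<Rightarrow> nat \<Rightarrow> (nat \<Rightarrow> complex vec) \<Rightarrow> bool" where
  "orthonormal N k f \<longleftrightarrow> (\<forall>i<k. f i \<in> carrier_vec N) \<and>
     (\<forall>i<k. \<forall>j<k. f i \<bullet>c f j = (if i = j then 1 else 0))"

lemma cscalar_prod_commute:
  fixes x y :: "complex vec"
  assumes "x \<in> carrier_vec N" "y \<in> carrier_vec N"
  shows "x \<bullet>c y = cnj (y \<bullet>c x)"
  using assms by (auto simp: scalar_prod_def conjugate_complex_def mult_ac intro!: sum.cong)

lemma orthonormal_Suc:
  assumes f: "orthonormal N k f" and x: "x \<in> carrier_vec N" "x \<bullet>c x = 1" "\<And>i. i < k \<Longrightarrow> x \<bullet>c f i = 0"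
  shows "orthonormal N (Suc k) (f(k := x))"
proof -
  have "f i \<bullet>c x = 0" if "i < k" for i
    using cscalar_prod_commute[of "f i" N x] x f that by (auto simp: orthonormal_def)
  then show ?thesis using assms by (auto simp: orthonormal_def less_Suc_eq)
qed

lemma normalize_vec:
  fixes z :: "complex vec"
  assumes "z \<in> carrier_vec N" "z \<noteq> 0\<^sub>v N"
  shows "\<exists>c. (c \<cdot>\<^sub>v z) \<bullet>c (c \<cdot>\<^sub>v z) = 1"
proof -
  have p: "vnorm z > 0" by (rule vnorm_pos[OF assms])
  have "vnorm (of_real (1 / vnorm z) \<cdot>\<^sub>v z) = 1"
    using p by (simp add: vnorm_smult norm_divide)
  then show ?thesis by (metis vnorm_sq of_real_1 power_one)
qed

lemma orthonormal_extend_one: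
  assumes f: "orthonormal N k f" and k: "k < N"
  shows "\<exists>x. orthonormal N (Suc k) (f(k := x))"
proof -
  have "card ((\<lambda>i. conjugate (f i)) ` {..<k}) < N"
    using card_image_le[of "{..<k}" "\<lambda>i. conjugate (f i)"] k by simp
  moreover have "(\<lambda>i. conjugate (f i)) ` {..<k} \<subseteq> carrier_vec N"
    using f by (auto simp: orthonormal_def)
  ultimately obtain z where z: "z \<in> carrier_vec N" "z \<noteq> 0\<^sub>v N" "\<And>i. i < k \<Longrightarrow> conjugate (f i) \<bullet> z = 0"
    using exists_orthogonal_vector[of "(\<lambda>i. conjugate (f i)) ` {..<k}" N] by auto
  obtain c where c: "(c \<cdot>\<^sub>v z) \<bullet>c (c \<cdot>\<^sub>v z) = 1" using normalize_vec[OF z(1,2)] by blast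
  have "(c \<cdot>\<^sub>v z) \<bullet>c f i = 0" if "i < k" for i
  proof -
    have fi: "f i \<in> carrier_vec N" using f that by (auto simp: orthonormal_def)
    then show ?thesis using z(3)[OF that] comm_scalar_prod[of "conjugate (f i)" N z] z(1) by simp
  qed
  then show ?thesis using orthonormal_Suc[OF f, of "c \<cdot>\<^sub>v z"] c z by auto
qed

lemma orthonormal_extend:
  assumes "orthonormal N k f" "k \<le> N"
  shows "\<exists>g. orthonormal N N g \<and> (\<forall>i<k. g i = f i)"
  using assms
proof (induction "N - k" arbitrary: k f)
  case 0
  then show ?case by auto
next
  case (Suc m)
  then have k: "k < N" by simp
  obtain x where x: "orthonormal N (Suc k) (f(k := x))"
    using orthonormal_extend_one[OF Suc.prems(1) k] by blast
  have "m = N - Suc k" "Suc k \<le> N" using Suc.hyps(2) k by auto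
  then obtain g where "orthonormal N N g" "\<forall>i<Suc k. g i = (f(k := x)) i"
    using Suc.hyps(1)[OF _ x] by blast
  then show ?case by (intro exI[of _ g]) auto
qed

definition mat_of_columns :: "nat \<Rightarrow> (nat \<Rightarrow> complex vec) \<Rightarrow> complex mat" where
  "mat_of_columns N f = mat N N (\<lambda>(i, j). f j $ i)"

lemma mat_of_columns_adj_mult_vec:
  assumes "y \<in> carrier_vec N" "i < N" "f i \<in> carrier_vec N"
  shows "(adj (mat_of_columns N f) *\<^sub>v y) $ i = y \<bullet>c f i"
  using assms
  by (auto simp: mat_of_columns_def adj_def scalar_prod_def conjugate_complex_def mult_ac intro!: sum.cong)

lemma mat_of_columns_unit_vec:
  assumes "j < N" "f j \<in> carrier_vec N"
  shows "mat_of_columns N f *\<^sub>v unit_vec N j = f j"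
  using assms by (intro eq_vecI) (auto simp: mat_of_columns_def)

lemma mat_of_columns_unitary:
  assumes f: "orthonormal N N f"
  shows "unitary_mat N (mat_of_columns N f)"
  unfolding unitary_mat_def
proof
  show c: "mat_of_columns N f \<in> carrier_mat N N" by (simp add: mat_of_columns_def)
  show "adj (mat_of_columns N f) * mat_of_columns N f = 1\<^sub>m N"
  proof (rule eq_matI)
    fix i j assume "i < dim_row (1\<^sub>m N :: complex mat)" "j < dim_col (1\<^sub>m N :: complex mat)"
    then have ij: "i < N" "j < N" by auto
    have "(adj (mat_of_columns N f) * mat_of_columns N f) $$ (i, j) = f j \<bullet>c f i"
    proof -
      have "f i \<in> carrier_vec N" "f j \<in> carrier_vec N" using f ij by (auto simp: orthonormal_def)
      then show ?thesis
        using ij by (auto simp: mat_of_columns_def adj_def scalar_prod_def conjugate_complex_def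
          mult_ac intro!: sum.cong)
    qed
    then show "(adj (mat_of_columns N f) * mat_of_columns N f) $$ (i, j) = 1\<^sub>m N $$ (i, j)"
      using f ij by (simp add: orthonormal_def)
  qed (use c in \<open>auto simp: adj_def\<close>)
qed

text \<open>The orthogonal complement of a system of eigenvectors of a unitary matrix is
  invariant. In an orthonormal basis that extends the system, the compression to the complement is
  the lower right block \<open>A\<close> of \<open>Q\<^sup>* U Q\<close>, and an eigenvector of \<open>A\<close> becomes an eigenvector of \<open>U\<close>
  when it is filled up with zeros.\<close>

lemma unitary_extend_eigenvectors:
  assumes U: "unitary_mat N U" and f: "orthonormal N k f" and k: "k < N"
    and eig: "\<And>i. i < k \<Longrightarrow> U *\<^sub>v f i = d i \<cdot>\<^sub>v f i"
  shows "\<exists>x l. orthonormal N (Suc k) (f(k := x)) \<and> U *\<^sub>v x = l \<cdot>\<^sub>v x"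
proof -
  note Uc = unitary_mat_carrier[OF U]
  obtain g where g: "orthonormal N N g" "\<And>i. i < k \<Longrightarrow> g i = f i"
    using orthonormal_extend[OF f] k by auto
  have gc: "g i \<in> carrier_vec N" if "i < N" for i using g that by (auto simp: orthonormal_def)
  define Q where "Q = mat_of_columns N g"
  have Q: "unitary_mat N Q" unfolding Q_def by (rule mat_of_columns_unitary[OF g(1)])
  note Qc = unitary_mat_carrier[OF Q]
  define B where "B = adj Q * (U * Q)"
  have Bc: "B \<in> carrier_mat N N" using Uc Qc by (simp add: B_def)
  have Bij: "B $$ (i, j) = (U *\<^sub>v g j) \<bullet>c g i" if ij: "i < N" "j < N" for i j
  proof -
    have "B $$ (i, j) = (B *\<^sub>v unit_vec N j) $ i" using ij Bc by simp
    also have "B *\<^sub>v unit_vec N j = adj Q *\<^sub>v (U *\<^sub>v (Q *\<^sub>v unit_vec N j))"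
      using Uc Qc by (simp add: B_def assoc_mult_mat_vec[of _ N N _ N])
    also have "\<dots> $ i = (U *\<^sub>v g j) \<bullet>c g i"
      using Uc ij gc by (simp add: Q_def mat_of_columns_unit_vec mat_of_columns_adj_mult_vec)
    finally show ?thesis .
  qed
  have B0: "B $$ (i, j) = 0" if ij: "i < k" "k \<le> j" "j < N" for i j
  proof -
    have "B $$ (i, j) = g j \<bullet>c (adj U *\<^sub>v f i)"
      using ij k g(2) gc Bij cscalar_prod_adj[OF Uc gc gc] by simp
    moreover have "cnj (d i) * (g j \<bullet>c (adj U *\<^sub>v f i)) = 0"
    proof -
      have fi: "f i \<in> carrier_vec N" using f ij by (auto simp: orthonormal_def)
      have "cnj (d i) * (g j \<bullet>c (adj U *\<^sub>v f i)) = g j \<bullet>c (adj U *\<^sub>v (d i \<cdot>\<^sub>v f i))"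
        using fi Uc gc[OF ij(3)]
        by (simp add: mult_mat_vec[of _ N N] conjugate_smult_vec conjugate_complex_def)
      also have "\<dots> = g j \<bullet>c f i" using eig[OF ij(1)] unitary_cancel[OF U fi] by simp
      also have "\<dots> = 0" using g ij k by (simp add: orthonormal_def flip: g(2))
      finally show ?thesis .
    qed
    ultimately have "B $$ (i, j) = 0 \<or> d i = 0" by auto
    moreover have "d i \<noteq> 0"
    proof
      assume "d i = 0"
      have fi: "f i \<in> carrier_vec N" using f ij by (auto simp: orthonormal_def)
      have "f i \<bullet>c f i = 0"
        using cscalar_prod_unitary[OF U fi fi] eig[OF ij(1)] \<open>d i = 0\<close> fi by simp
      then show False using f ij by (auto simp: orthonormal_def)
    qed
    ultimately show ?thesis by simp
  qed
  define A where "A = mat (N - k) (N - k) (\<lambda>(i, j). B $$ (i + k, j + k))"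
  have Ac: "A \<in> carrier_mat (N - k) (N - k)" by (simp add: A_def)
  obtain l where "eigenvalue A l" using spectrum_non_empty[OF Ac] k by (auto simp: spectrum_def)
  then obtain w where w: "w \<in> carrier_vec (N - k)" "w \<noteq> 0\<^sub>v (N - k)" "A *\<^sub>v w = l \<cdot>\<^sub>v w"
    using Ac by (auto simp: eigenvalue_def eigenvector_def)
  define z where "z = vec N (\<lambda>i. if i < k then 0 else w $ (i - k))"
  have zc: "z \<in> carrier_vec N" by (simp add: z_def)
  have z0: "z \<noteq> 0\<^sub>v N"
  proof
    assume z: "z = 0\<^sub>v N"
    have "w $ i = 0" if "i < N - k" for i
    proof -
      have "z $ (i + k) = w $ i" using that by (simp add: z_def)
      then show ?thesis using z that by simp
    qed
    then show False using w by (metis carrier_vecD eq_vecI index_zero_vec)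
  qed
  have Bz: "B *\<^sub>v z = l \<cdot>\<^sub>v z"
  proof (rule eq_vecI)
    fix i assume "i < dim_vec (l \<cdot>\<^sub>v z)"
    then have i: "i < N" by (simp add: z_def)
    have split: "{..<N} = {..<k} \<union> (\<lambda>j. j + k) ` {..<N - k}"
    proof (intro Set.set_eqI iffI)
      fix x assume x: "x \<in> {..<N}"
      show "x \<in> {..<k} \<union> (\<lambda>j. j + k) ` {..<N - k}"
      proof (cases "x < k")
        case False
        then have "x = (x - k) + k" "x - k < N - k" using x by auto
        then show ?thesis by blast
      qed simp
    qed (use k in auto)
    have "(B *\<^sub>v z) $ i = (\<Sum>j<N. B $$ (i, j) * z $ j)"
      by (rule index_mult_mat_vec_sum[OF Bc zc i])
    also have "\<dots> = (\<Sum>j<N - k. B $$ (i, j + k) * w $ j)"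
    proof -
      have "(\<Sum>j<k. B $$ (i, j) * z $ j) = 0"
        using k by (intro sum.neutral) (simp add: z_def)
      moreover have "(\<Sum>j<N - k. B $$ (i, j + k) * z $ (j + k)) = (\<Sum>j<N - k. B $$ (i, j + k) * w $ j)"
        by (intro sum.cong) (auto simp: z_def)
      ultimately show ?thesis
        unfolding split by (subst sum.union_disjoint) (auto simp: sum.reindex inj_on_def)
    qed
    also have "\<dots> = l * z $ i"
    proof (cases "i < k")
      case True
      then show ?thesis using B0 i by (auto simp: z_def intro!: sum.neutral)
    next
      case False
      have "(\<Sum>j<N - k. B $$ (i, j + k) * w $ j) = (A *\<^sub>v w) $ (i - k)"
        using False i by (subst index_mult_mat_vec_sum[OF Ac w(1)]) (auto simp: A_def intro!: sum.cong)
      then show ?thesis using False i w by (simp add: z_def)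
    qed
    finally show "(B *\<^sub>v z) $ i = (l \<cdot>\<^sub>v z) $ i" using i zc by simp
  qed (use Bc zc in auto)
  obtain c where c: "(c \<cdot>\<^sub>v z) \<bullet>c (c \<cdot>\<^sub>v z) = 1" using normalize_vec[OF zc z0] by blast
  define x where "x = Q *\<^sub>v (c \<cdot>\<^sub>v z)"
  have xc: "x \<in> carrier_vec N" using Qc zc by (simp add: x_def)
  have "x \<bullet>c x = 1" unfolding x_def using cscalar_prod_unitary[OF Q, of "c \<cdot>\<^sub>v z" "c \<cdot>\<^sub>v z"] zc c by simp
  moreover have "x \<bullet>c f i = 0" if i: "i < k" for i
  proof -
    have "f i = Q *\<^sub>v unit_vec N i"
      using mat_of_columns_unit_vec[of i N g] gc[of i] g(2)[OF i] i k by (simp add: Q_def)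
    then have "x \<bullet>c f i = (c \<cdot>\<^sub>v z) \<bullet>c unit_vec N i"
      unfolding x_def using cscalar_prod_unitary[OF Q, of "c \<cdot>\<^sub>v z" "unit_vec N i"] zc by simp
    also have "\<dots> = cnj (unit_vec N i \<bullet>c (c \<cdot>\<^sub>v z))"
      by (rule cscalar_prod_commute) (use zc in auto)
    also have "\<dots> = 0" using i k zc by (simp add: z_def conjugate_complex_def)
    finally show ?thesis .
  qed
  moreover have "U *\<^sub>v x = l \<cdot>\<^sub>v x"
  proof -
    have "U *\<^sub>v (Q *\<^sub>v z) = Q *\<^sub>v (B *\<^sub>v z)"
      using Uc Qc zc unitary_cancel(2)[OF Q, of "U *\<^sub>v (Q *\<^sub>v z)"]
      by (simp add: B_def assoc_mult_mat_vec[of _ N N _ N])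
    then show ?thesis
      using Uc Qc zc by (simp add: x_def Bz mult_mat_vec[of _ N N] smult_smult_assoc mult.commute)
  qed
  ultimately show ?thesis using orthonormal_Suc[OF f xc] by blast
qed

lemma unitary_diagonalizable:
  assumes U: "unitary_mat N U"
  shows "\<exists>V d. unitary_mat N V \<and> U * V = V * mat_diag N d"
proof -
  have "\<exists>f d. orthonormal N k f \<and> (\<forall>i<k. U *\<^sub>v f i = d i \<cdot>\<^sub>v f i)" if "k \<le> N" for k
    using that
  proof (induction k)
    case 0
    then show ?case by (auto simp: orthonormal_def)
  next
    case (Suc k)
    then obtain f d where fd: "orthonormal N k f" "\<forall>i<k. U *\<^sub>v f i = d i \<cdot>\<^sub>v f i" by auto
    obtain x l where "orthonormal N (Suc k) (f(k := x))" "U *\<^sub>v x = l \<cdot>\<^sub>v x"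
      using unitary_extend_eigenvectors[OF U fd(1), of d] fd(2) Suc.prems by auto
    moreover from this have "\<forall>i<Suc k. U *\<^sub>v (f(k := x)) i = (d(k := l)) i \<cdot>\<^sub>v (f(k := x)) i"
      using fd by (auto simp: less_Suc_eq)
    ultimately show ?case by blast
  qed
  then obtain f d where fd: "orthonormal N N f" "\<And>i. i < N \<Longrightarrow> U *\<^sub>v f i = d i \<cdot>\<^sub>v f i" by blast
  let ?V = "mat_of_columns N f"
  note Uc = unitary_mat_carrier[OF U]
  have V: "unitary_mat N ?V" by (rule mat_of_columns_unitary[OF fd(1)])
  note Vc = unitary_mat_carrier[OF V]
  have Dc: "mat_diag N d \<in> carrier_mat N N" by (simp add: mat_diag_dim)
  have "U * ?V = ?V * mat_diag N d"
  proof (rule eq_matI)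
    fix i j assume "i < dim_row (?V * mat_diag N d)" "j < dim_col (?V * mat_diag N d)"
    then have ij: "i < N" "j < N" using Vc carrier_matD[OF Dc] by auto
    have fj: "f j \<in> carrier_vec N" using fd ij by (auto simp: orthonormal_def)
    have "col ?V j = f j" using ij fj by (intro eq_vecI) (auto simp: mat_of_columns_def)
    then have "(U * ?V) $$ (i, j) = (U *\<^sub>v f j) $ i" using ij Uc Vc by simp
    then show "(U * ?V) $$ (i, j) = (?V * mat_diag N d) $$ (i, j)"
      using fd(2)[OF ij(2)] fj ij Vc
      by (simp add: mat_diag_mult_right[OF Vc]) (simp add: mat_of_columns_def)
  qed (use Uc Vc carrier_matD[OF Dc] in auto)
  then show ?thesis using V by blast
qed

section \<open>Rank bounds and correction of almost involutions\<close>

lemma mat_diag_carrier [simp]: "mat_diag N d \<in> carrier_mat N N"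
  by (simp add: mat_diag_def)

lemma mat_diag_mult_vec:
  fixes d :: "nat \<Rightarrow> complex"
  assumes z: "z \<in> carrier_vec N"
  shows "mat_diag N d *\<^sub>v z = vec N (\<lambda>i. d i * z $ i)"
proof (rule eq_vecI)
  fix i assume "i < dim_vec (vec N (\<lambda>i. d i * z $ i))"
  then have i: "i < N" by simp
  have "(mat_diag N d *\<^sub>v z) $ i = (\<Sum>l<N. (if i = l then d i * z $ l else 0))"
    unfolding index_mult_mat_vec_sum[OF mat_diag_carrier z i]
    using i by (intro sum.cong) (auto simp: mat_diag_def)
  then show "(mat_diag N d *\<^sub>v z) $ i = vec N (\<lambda>i. d i * z $ i) $ i"
    using i by simp
qed (simp add: mat_diag_def)

lemma diagonalized_mult_vec:
  assumes V: "unitary_mat N V" and A: "A \<in> carrier_mat N N" and AV: "A * V = V * mat_diag N g"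
    and z: "z \<in> carrier_vec N"
  shows "A *\<^sub>v (V *\<^sub>v z) = V *\<^sub>v vec N (\<lambda>i. g i * z $ i)"
proof -
  note Vc = unitary_mat_carrier[OF V]
  have "A *\<^sub>v (V *\<^sub>v z) = (A * V) *\<^sub>v z" using A Vc z by (simp add: assoc_mult_mat_vec)
  also have "\<dots> = V *\<^sub>v (mat_diag N g *\<^sub>v z)"
    unfolding AV using assoc_mult_mat_vec[OF Vc mat_diag_carrier z] .
  finally show ?thesis by (simp add: mat_diag_mult_vec[OF z])
qed

lemma diagonalized_opbound:
  assumes V: "unitary_mat N V" and A: "A \<in> carrier_mat N N" and AV: "A * V = V * mat_diag N g"
    and C: "0 \<le> C" "\<And>i. i < N \<Longrightarrow> cmod (g i) \<le> C"
  shows "opbound N A C"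
  unfolding opbound_def
proof
  fix v :: "complex vec" assume v: "v \<in> carrier_vec N"
  note Vc = unitary_mat_carrier[OF V]
  define z where "z = adj V *\<^sub>v v"
  have z: "z \<in> carrier_vec N" "v = V *\<^sub>v z" using Vc v unitary_cancel[OF V v] by (auto simp: z_def)
  have "vnorm (A *\<^sub>v v) = vnorm (vec N (\<lambda>i. g i * z $ i))"
    unfolding z(2) diagonalized_mult_vec[OF V A AV z(1)] by (rule vnorm_unitary[OF V]) simp
  also have "\<dots> \<le> C * vnorm z"
    by (rule vnorm_pointwise[of _ N]) (use C z in \<open>auto simp: norm_mult intro!: mult_right_mono\<close>)
  also have "vnorm z = vnorm v" using vnorm_unitary[OF V z(1)] z by simp
  finally show "vnorm (A *\<^sub>v v) \<le> C * vnorm v" .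
qed

lemma opbound_diagonalized:
  assumes V: "unitary_mat N V" and A: "A \<in> carrier_mat N N" and AV: "A * V = V * mat_diag N g"
    and C: "opbound N A C" and i: "i < N"
  shows "cmod (g i) \<le> C"
proof -
  let ?e = "unit_vec N i :: complex vec"
  have e: "?e \<in> carrier_vec N" by simp
  have "vnorm ?e = 1"
  proof -
    have "complex_of_real ((vnorm ?e)\<^sup>2) = 1" unfolding vnorm_sq using i by (simp add: conjugate_complex_def)
    then have "(vnorm ?e)\<^sup>2 = 1" by (metis of_real_eq_1_iff)
    then show ?thesis using vnorm_nonneg[of ?e] by (simp add: power2_eq_1_iff)
  qed
  moreover have "vec N (\<lambda>j. g j * ?e $ j) = g i \<cdot>\<^sub>v ?e" by (intro eq_vecI) (auto simp: unit_vec_def)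
  ultimately have "vnorm (A *\<^sub>v (V *\<^sub>v ?e)) = cmod (g i)" "vnorm (V *\<^sub>v ?e) = 1"
    using vnorm_unitary[OF V] i
    by (simp_all add: diagonalized_mult_vec[OF V A AV e] vnorm_smult)
  then show ?thesis using C unitary_mat_carrier[OF V] by (auto simp: opbound_def dest!: bspec[of _ _ "V *\<^sub>v ?e"])
qed

text \<open>Counting linear equations that cut out a part of the kernel, rather than the dimension of
  the range, makes the behaviour under sums and products immediate and turns comparisons of ranks
  into the solvability of homogeneous systems.\<close>

definition rank_le :: "nat \<Rightarrow> complex mat \<Rightarrow> nat \<Rightarrow> bool" where
  "rank_le N A k \<longleftrightarrow> (\<exists>F. finite F \<and> F \<subseteq> carrier_vec N \<and> card F \<le> k \<and>
     (\<forall>v\<in>carrier_vec N. (\<forall>f\<in>F. f \<bullet> v = 0) \<longrightarrow> A *\<^sub>v v = 0\<^sub>v N))"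

text \<open>For a unitary matrix close to an involution and \<open>r < 1\<close> this says that at most \<open>k\<close>
  eigenvalues lie near \<open>-1\<close>. Unlike a count of eigenvalues, the condition visibly survives a small
  perturbation of \<open>A\<close>.\<close>

definition near_one_off :: "nat \<Rightarrow> complex mat \<Rightarrow> nat \<Rightarrow> real \<Rightarrow> bool" where
  "near_one_off N A k r \<longleftrightarrow> (\<exists>F. finite F \<and> F \<subseteq> carrier_vec N \<and> card F \<le> k \<and>
     (\<forall>v\<in>carrier_vec N. (\<forall>f\<in>F. f \<bullet> v = 0) \<longrightarrow> vnorm (A *\<^sub>v v - v) \<le> r * vnorm v))"

lemma rank_le_add:
  assumes "rank_le N A k" "rank_le N B l" "A \<in> carrier_mat N N" "B \<in> carrier_mat N N"
  shows "rank_le N (A + B) (k + l)"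
proof -
  obtain F G where F: "finite F" "F \<subseteq> carrier_vec N" "card F \<le> k"
      "\<And>v. v \<in> carrier_vec N \<Longrightarrow> (\<forall>f\<in>F. f \<bullet> v = 0) \<Longrightarrow> A *\<^sub>v v = 0\<^sub>v N"
    and G: "finite G" "G \<subseteq> carrier_vec N" "card G \<le> l"
      "\<And>v. v \<in> carrier_vec N \<Longrightarrow> (\<forall>f\<in>G. f \<bullet> v = 0) \<Longrightarrow> B *\<^sub>v v = 0\<^sub>v N"
    using assms unfolding rank_le_def by metis
  show ?thesis
    unfolding rank_le_def
  proof (intro exI[of _ "F \<union> G"] conjI ballI impI)
    show "card (F \<union> G) \<le> k + l" using F G card_Un_le[of F G] by linarith
    fix v assume "v \<in> carrier_vec N" "\<forall>f\<in>F \<union> G. f \<bullet> v = 0"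
    then show "(A + B) *\<^sub>v v = 0\<^sub>v N"
      using F G assms by (simp add: add_mult_distrib_mat_vec[of _ N N])
  qed (use F G in auto)
qed

lemma rank_le_mult_left:
  assumes "rank_le N A k" "A \<in> carrier_mat N N" "B \<in> carrier_mat N N"
  shows "rank_le N (B * A) k"
proof -
  have "B *\<^sub>v 0\<^sub>v N = 0\<^sub>v N" using assms by auto
  then show ?thesis using assms unfolding rank_le_def
    by (metis assoc_mult_mat_vec)
qed

lemma rank_le_mult_right:
  assumes A: "rank_le N A k" and c: "A \<in> carrier_mat N N" "B \<in> carrier_mat N N"
  shows "rank_le N (A * B) k"
proof -
  obtain F where F: "finite F" "F \<subseteq> carrier_vec N" "card F \<le> k"
      "\<And>v. v \<in> carrier_vec N \<Longrightarrow> (\<forall>f\<in>F. f \<bullet> v = 0) \<Longrightarrow> A *\<^sub>v v = 0\<^sub>v N"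
    using A unfolding rank_le_def by metis
  show ?thesis
    unfolding rank_le_def
  proof (intro exI[of _ "(\<lambda>f. B\<^sup>T *\<^sub>v f) ` F"] conjI ballI impI)
    show "card ((\<lambda>f. B\<^sup>T *\<^sub>v f) ` F) \<le> k" using F card_image_le order_trans by blast
    fix v assume v: "v \<in> carrier_vec N" "\<forall>f\<in>(\<lambda>f. B\<^sup>T *\<^sub>v f) ` F. f \<bullet> v = 0"
    have "f \<bullet> (B *\<^sub>v v) = 0" if "f \<in> F" for f
      using transpose_vec_mult_scalar[OF c(2) v(1), of f] v(2) F(2) that by auto
    then show "A * B *\<^sub>v v = 0\<^sub>v N"
      using F(4)[of "B *\<^sub>v v"] c v by (simp add: assoc_mult_mat_vec[of _ N N _ N])
  qed (use F c in auto)
qed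

lemma diagonalized_rank_le:
  assumes V: "unitary_mat N V" and A: "A \<in> carrier_mat N N" and AV: "A * V = V * mat_diag N g"
  shows "rank_le N A (card {i. i < N \<and> g i \<noteq> 0})"
  unfolding rank_le_def
proof (intro exI[of _ "(\<lambda>i. row (adj V) i) ` {i. i < N \<and> g i \<noteq> 0}"] conjI ballI impI)
  note Vc = unitary_mat_carrier[OF V]
  show "card ((\<lambda>i. row (adj V) i) ` {i. i < N \<and> g i \<noteq> 0}) \<le> card {i. i < N \<and> g i \<noteq> 0}"
    by (rule card_image_le) simp
  show "(\<lambda>i. row (adj V) i) ` {i. i < N \<and> g i \<noteq> 0} \<subseteq> carrier_vec N"
    using Vc by (auto intro!: row_carrier_vec[of _ N])
  fix v assume v: "v \<in> carrier_vec N" "\<forall>f\<in>(\<lambda>i. row (adj V) i) ` {i. i < N \<and> g i \<noteq> 0}. f \<bullet> v = 0"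
  define z where "z = adj V *\<^sub>v v"
  have z: "z \<in> carrier_vec N" "v = V *\<^sub>v z" using Vc v unitary_cancel[OF V v(1)] by (auto simp: z_def)
  have "vec N (\<lambda>i. g i * z $ i) = 0\<^sub>v N"
    using v(2) Vc by (intro eq_vecI) (auto simp: z_def)
  then show "A *\<^sub>v v = 0\<^sub>v N"
    unfolding z(2) diagonalized_mult_vec[OF V A AV z(1)] using Vc by auto
qed simp

text \<open>The coordinates outside \<open>S\<close> and the functionals in \<open>F\<close> impose fewer than \<open>N\<close>
  equations on \<open>z\<close>. It is applied to a matrix \<open>V\<close> of eigenvectors, where \<open>V z\<close> runs through the
  span of the eigenvectors selected by \<open>S\<close>.\<close>

lemma eigenspace_meets_annihilator:
  fixes V :: "complex mat"
  assumes V: "V \<in> carrier_mat N N" and F: "finite F" "F \<subseteq> carrier_vec N"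
    and S: "S \<subseteq> {..<N}" "card F < card S"
  shows "\<exists>z\<in>carrier_vec N. z \<noteq> 0\<^sub>v N \<and> (\<forall>i<N. i \<notin> S \<longrightarrow> z $ i = 0) \<and> (\<forall>f\<in>F. f \<bullet> (V *\<^sub>v z) = 0)"
proof -
  define G where "G = (\<lambda>f. V\<^sup>T *\<^sub>v f) ` F \<union> unit_vec N ` ({..<N} - S)"
  have "card G \<le> card ((\<lambda>f. V\<^sup>T *\<^sub>v f) ` F) + card (unit_vec N ` ({..<N} - S) :: complex vec set)"
    unfolding G_def by (rule card_Un_le)
  also have "\<dots> \<le> card F + card ({..<N} - S)"
    using F by (intro add_mono card_image_le) auto
  also have "\<dots> = card F + (N - card S)"
    using S finite_subset[OF S(1)] by (simp add: card_Diff_subset)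
  also have "\<dots> < N" using S card_mono[OF _ S(1)] by simp
  finally have "card G < N" .
  moreover have "finite G" "G \<subseteq> carrier_vec N" using F V by (auto simp: G_def)
  ultimately obtain z where z: "z \<in> carrier_vec N" "z \<noteq> 0\<^sub>v N" "\<And>g. g \<in> G \<Longrightarrow> g \<bullet> z = 0"
    using exists_orthogonal_vector[of G N] by blast
  have "z $ i = 0" if "i < N" "i \<notin> S" for i
    using z(3)[of "unit_vec N i"] z(1) that by (auto simp: G_def)
  moreover have "f \<bullet> (V *\<^sub>v z) = 0" if "f \<in> F" for f
    using z(3)[of "V\<^sup>T *\<^sub>v f"] transpose_vec_mult_scalar[OF V z(1), of f] F(2) that by (auto simp: G_def)
  ultimately show ?thesis using z by blast
qed

text \<open>More than \<open>k\<close> nonzero eigenvalues would leave a nonzero combination of their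
  eigenvectors on which \<open>A\<close> vanishes.\<close>

lemma card_nonzero_le_rank:
  assumes V: "unitary_mat N V" and A: "A \<in> carrier_mat N N" and AV: "A * V = V * mat_diag N g"
    and rk: "rank_le N A k"
  shows "card {i. i < N \<and> g i \<noteq> 0} \<le> k"
proof (rule ccontr)
  let ?S = "{i. i < N \<and> g i \<noteq> 0}"
  assume "\<not> card ?S \<le> k"
  obtain F where F: "finite F" "F \<subseteq> carrier_vec N" "card F \<le> k"
      "\<And>v. v \<in> carrier_vec N \<Longrightarrow> (\<forall>f\<in>F. f \<bullet> v = 0) \<Longrightarrow> A *\<^sub>v v = 0\<^sub>v N"
    using rk unfolding rank_le_def by metis
  note Vc = unitary_mat_carrier[OF V]
  obtain z where z: "z \<in> carrier_vec N" "z \<noteq> 0\<^sub>v N" "\<forall>i<N. i \<notin> ?S \<longrightarrow> z $ i = 0"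
      "\<forall>f\<in>F. f \<bullet> (V *\<^sub>v z) = 0"
    using eigenspace_meets_annihilator[OF Vc F(1,2), of ?S] F(3) \<open>\<not> card ?S \<le> k\<close> by auto
  have "V *\<^sub>v vec N (\<lambda>i. g i * z $ i) = 0\<^sub>v N"
    using F(4)[of "V *\<^sub>v z"] z Vc diagonalized_mult_vec[OF V A AV z(1)] by simp
  then have "vnorm (vec N (\<lambda>i. g i * z $ i)) = 0"
    using vnorm_unitary[OF V, of "vec N (\<lambda>i. g i * z $ i)"] by simp
  then have "vec N (\<lambda>i. g i * z $ i) = 0\<^sub>v N" by (subst (asm) vnorm_eq_0[of _ N]) auto
  then have *: "g i * z $ i = 0" if "i < N" for i using that by (metis index_vec index_zero_vec(1))
  have "z $ i = 0" if "i < N" for i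
    using z(3) *[OF that] that by (cases "g i = 0") auto
  then have "z = 0\<^sub>v N" using z(1) by (intro eq_vecI) auto
  then show False using z by simp
qed

lemma near_one_off_perturb:
  assumes A: "near_one_off N A k r" and c: "A \<in> carrier_mat N N" "B \<in> carrier_mat N N"
    and AB: "opbound N (B - A) s"
  shows "near_one_off N B k (r + s)"
proof -
  obtain F where F: "finite F" "F \<subseteq> carrier_vec N" "card F \<le> k"
      "\<And>v. v \<in> carrier_vec N \<Longrightarrow> (\<forall>f\<in>F. f \<bullet> v = 0) \<Longrightarrow> vnorm (A *\<^sub>v v - v) \<le> r * vnorm v"
    using A unfolding near_one_off_def by metis
  show ?thesis
    unfolding near_one_off_def
  proof (intro exI[of _ F] conjI ballI impI)
    fix v assume v: "v \<in> carrier_vec N" "\<forall>f\<in>F. f \<bullet> v = 0"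
    have "B *\<^sub>v v - v = (A *\<^sub>v v - v) + (B - A) *\<^sub>v v"
      using c v by (simp add: minus_mult_distrib_mat_vec[of _ N N]) (intro eq_vecI, auto)
    then have "vnorm (B *\<^sub>v v - v) \<le> vnorm (A *\<^sub>v v - v) + vnorm ((B - A) *\<^sub>v v)"
      using c v vnorm_add[of "A *\<^sub>v v - v" N "(B - A) *\<^sub>v v"] by simp
    also have "\<dots> \<le> r * vnorm v + s * vnorm v"
      using F(4)[OF v] AB v by (intro add_mono) (auto simp: opbound_def)
    finally show "vnorm (B *\<^sub>v v - v) \<le> (r + s) * vnorm v" by (simp add: algebra_simps)
  qed (use F in auto)
qed

lemma rank_le_near_one_off:
  assumes "rank_le N (A - 1\<^sub>m N) k" "A \<in> carrier_mat N N"
  shows "near_one_off N A k 0"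
proof -
  have "A *\<^sub>v v - v = (A - 1\<^sub>m N) *\<^sub>v v" if "v \<in> carrier_vec N" for v
    using assms that by (simp add: minus_mult_distrib_mat_vec[of _ N N])
  then show ?thesis using assms unfolding rank_le_def near_one_off_def by (metis mult_zero_left order_refl vnorm_zero)
qed

lemma mat_diag_unitary:
  assumes "\<And>i. i < N \<Longrightarrow> cmod (d i) = 1"
  shows "unitary_mat N (mat_diag N d)"
proof -
  have "adj (mat_diag N d) = mat_diag N (\<lambda>i. cnj (d i))"
    by (rule eq_matI) (auto simp: adj_def mat_diag_def)
  moreover have "mat_diag N (\<lambda>i. cnj (d i) * d i) = 1\<^sub>m N"
  proof (rule eq_matI)
    fix i j assume "i < dim_row (1\<^sub>m N :: complex mat)" "j < dim_col (1\<^sub>m N :: complex mat)"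
    moreover from this have "cnj (d i) * d i = 1"
      using assms[of i] complex_norm_square[of "d i"] by (simp add: mult.commute)
    moreover note assms[of j] complex_norm_square[of "d j"]
    ultimately show "mat_diag N (\<lambda>i. cnj (d i) * d i) $$ (i, j) = 1\<^sub>m N $$ (i, j)"
      by (auto simp: mat_diag_def mult.commute)
  qed (auto simp: mat_diag_def)
  ultimately show ?thesis by (simp add: unitary_mat_def)
qed

text \<open>Each eigenvalue \<open>d\<close> of \<open>b\<close> is rounded to \<open>e = \<plusminus>1\<close> according to the sign of its real
  part. Then \<open>\<bar>d + e\<bar> \<ge> 1\<close>, so that \<open>\<bar>d - e\<bar> \<le> \<bar>d\<^sup>2 - 1\<bar> \<le> \<delta>\<close>. The vectors spanned by eigenvectors with
  eigenvalue rounded to \<open>-1\<close> are moved by \<open>b\<close> by at least their full length; if there were more than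
  \<open>k\<close> such eigenvalues, one of these vectors would satisfy the \<open>k\<close> equations that bound the
  displacement by a factor \<open>r < 1\<close>.\<close>

lemma almost_involution_correction:
  assumes b: "unitary_mat N b" and inv: "opbound N (b * b - 1\<^sub>m N) \<delta>"
    and near: "near_one_off N b k r" "r < 1"
  shows "\<exists>b'. unitary_mat N b' \<and> opbound N (b - b') \<delta> \<and> rank_le N (b' - 1\<^sub>m N) k"
proof -
  note bc = unitary_mat_carrier[OF b]
  obtain V d where V: "unitary_mat N V" and bV: "b * V = V * mat_diag N d"
    using unitary_diagonalizable[OF b] by blast
  note Vc = unitary_mat_carrier[OF V]
  define e :: "nat \<Rightarrow> complex" where "e i = (if Re (d i) < 0 then -1 else 1)" for i
  define b' where "b' = V * mat_diag N e * adj V"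
  have b': "unitary_mat N b'"
    unfolding b'_def by (intro unitary_mat_mult unitary_mat_adj V mat_diag_unitary) (simp add: e_def)
  note b'c = unitary_mat_carrier[OF b']
  have b'V: "b' * V = V * mat_diag N e"
    using Vc by (simp add: b'_def square_mat_assoc[of _ N] unitary_mat_left[OF V])
  have diag_diff: "(X - Y) * V = V * mat_diag N (\<lambda>i. f i - g i)"
    if "X * V = V * mat_diag N f" "Y * V = V * mat_diag N g" "X \<in> carrier_mat N N" "Y \<in> carrier_mat N N"
    for X Y :: "complex mat" and f g
  proof -
    have "(X - Y) * V = V * mat_diag N f - V * mat_diag N g"
      using that Vc by (simp add: minus_mult_distrib_mat[of _ N N])
    also have "\<dots> = V * (mat_diag N f - mat_diag N g)"
      using mult_minus_distrib_mat[OF Vc mat_diag_carrier mat_diag_carrier] by simp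
    also have "mat_diag N f - mat_diag N g = mat_diag N (\<lambda>i. f i - g i)"
      by (rule eq_matI) (auto simp: mat_diag_def)
    finally show ?thesis .
  qed
  have one: "1\<^sub>m N * V = V * mat_diag N (\<lambda>i. 1)"
    using Vc by (simp add: mat_diag_one)
  have bb: "b * b * V = V * mat_diag N (\<lambda>i. d i * d i)"
  proof -
    have "b * b * V = b * (V * mat_diag N d)"
      using bc Vc by (simp add: square_mat_assoc[of _ N] bV)
    also have "\<dots> = (b * V) * mat_diag N d"
      using bc Vc by (simp add: square_mat_assoc[of _ N])
    also have "\<dots> = V * mat_diag N (\<lambda>i. d i * d i)"
      unfolding bV using Vc by (simp add: square_mat_assoc[of _ N])
    finally show ?thesis .
  qed
  have d2: "cmod (d i * d i - 1) \<le> \<delta>" if "i < N" for i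
    using opbound_diagonalized[OF V _ diag_diff[OF bb one] inv that] bc by simp
  have de: "cmod (d i - e i) \<le> \<delta>" if "i < N" for i
  proof -
    have "d i * d i - 1 = (d i - e i) * (d i + e i)" by (simp add: e_def algebra_simps)
    moreover have "1 \<le> cmod (d i + e i)"
      using abs_Re_le_cmod[of "d i + e i"] by (simp add: e_def split: if_splits)
    ultimately have "cmod (d i - e i) \<le> cmod (d i * d i - 1)"
      using mult_left_mono[of 1 "cmod (d i + e i)" "cmod (d i - e i)"] by (simp add: norm_mult)
    then show ?thesis using d2[OF that] by simp
  qed
  have "opbound N (b - b') \<delta>"
  proof (cases "N = 0")
    case True
    then show ?thesis using bc b'c by (auto simp: opbound_def vnorm_def)
  next
    case False
    then have "0 \<le> \<delta>" using d2[of 0] norm_ge_zero order_trans by blast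
    then show ?thesis
      by (intro diagonalized_opbound[OF V _ diag_diff[OF bV b'V bc b'c]]) (use bc b'c de in auto)
  qed
  moreover have "rank_le N (b' - 1\<^sub>m N) k"
  proof -
    let ?S = "{i. i < N \<and> e i - 1 \<noteq> 0}"
    have "card ?S \<le> k"
    proof (rule ccontr)
      assume "\<not> card ?S \<le> k"
      obtain F where F: "finite F" "F \<subseteq> carrier_vec N" "card F \<le> k"
          "\<And>v. v \<in> carrier_vec N \<Longrightarrow> (\<forall>f\<in>F. f \<bullet> v = 0) \<Longrightarrow> vnorm (b *\<^sub>v v - v) \<le> r * vnorm v"
        using near(1) unfolding near_one_off_def by metis
      obtain z where z: "z \<in> carrier_vec N" "z \<noteq> 0\<^sub>v N" "\<forall>i<N. i \<notin> ?S \<longrightarrow> z $ i = 0"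
          "\<forall>f\<in>F. f \<bullet> (V *\<^sub>v z) = 0"
        using eigenspace_meets_annihilator[OF Vc F(1,2), of ?S] F(3) \<open>\<not> card ?S \<le> k\<close> by auto
      have Vz: "V *\<^sub>v z \<in> carrier_vec N" using Vc z by simp
      define u where "u = vec N (\<lambda>i. (d i - 1) * z $ i)"
      have "b *\<^sub>v (V *\<^sub>v z) - V *\<^sub>v z = (b - 1\<^sub>m N) *\<^sub>v (V *\<^sub>v z)"
        using bc Vz by (simp add: minus_mult_distrib_mat_vec[of _ N N])
      also have "\<dots> = V *\<^sub>v u"
        unfolding u_def
        by (rule diagonalized_mult_vec[OF V _ diag_diff[OF bV one] z(1)]) (use bc in auto)
      finally have "vnorm u \<le> r * vnorm z"
        using F(4)[OF Vz z(4)] vnorm_unitary[OF V] z(1) by (simp add: u_def)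
      moreover have "vnorm z \<le> 1 * vnorm u"
      proof (rule vnorm_pointwise[of _ N])
        fix i assume i: "i < N"
        show "cmod (z $ i) \<le> 1 * cmod (u $ i)"
        proof (cases "i \<in> ?S")
          case True
          then have "1 \<le> cmod (d i - 1)"
            using abs_Re_le_cmod[of "d i - 1"] by (auto simp: e_def split: if_splits)
          then show ?thesis using i mult_right_mono[of 1 "cmod (d i - 1)" "cmod (z $ i)"]
            by (simp add: u_def norm_mult)
        qed (use i z(3) in auto)
      qed (use z in \<open>auto simp: u_def\<close>)
      moreover have "vnorm z > 0" by (rule vnorm_pos[OF z(1,2)])
      then have "r * vnorm z < 1 * vnorm z" using near(2) by (rule mult_strict_right_mono[rotated])
      ultimately show False by linarith
    qed
    then show ?thesis
      using diagonalized_rank_le[OF V _ diag_diff[OF b'V one]] b'c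
      unfolding rank_le_def by (meson order_trans minus_carrier_mat one_carrier_mat)
  qed
  ultimately show ?thesis using b' by blast
qed

text \<open>The perturbation weakens the factor \<open>1/2\<close> to \<open>3/4\<close>, which is still below \<open>1\<close>. Rounding the
  eigenvalues gives a matrix that is exactly \<open>1\<close> off \<open>k\<close> dimensions, and going back to \<open>b\<close> costs only
  \<open>\<delta> \<le> 1/2\<close>: the factor \<open>1/2\<close> is restored and the lemma can be iterated.\<close>

lemma near_one_off_stable:
  assumes b: "unitary_mat N b" "unitary_mat N b'" and inv: "opbound N (b * b - 1\<^sub>m N) \<delta>" "\<delta> \<le> 1/2"
    and near: "near_one_off N b' k (1/2)" and close: "opbound N (b - b') (1/4)"
  shows "near_one_off N b k (1/2)"
proof -
  note c = unitary_mat_carrier[OF b(1)] unitary_mat_carrier[OF b(2)]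
  have "near_one_off N b k (3/4)"
    using near_one_off_perturb[OF near c(2,1) close] by simp
  then obtain b'' where b'': "unitary_mat N b''" "opbound N (b - b'') \<delta>" "rank_le N (b'' - 1\<^sub>m N) k"
    using almost_involution_correction[OF b(1) inv(1)] by fastforce
  have "near_one_off N b k (0 + 1/2)"
    by (rule near_one_off_perturb[OF rank_le_near_one_off[OF b''(3)]])
      (use b'' c inv opbound_mono in \<open>auto dest: unitary_mat_carrier\<close>)
  then show ?thesis by simp
qed

section \<open>The Bott index of an almost commuting pair\<close>

text \<open>The segment from \<open>ca\<close> to \<open>ac\<close>; its determinant describes a closed curve, because both
  ends have the same determinant.\<close>

definition comm_segment :: "complex mat \<Rightarrow> complex mat \<Rightarrow> real \<Rightarrow> complex mat" where
  "comm_segment a c s = of_real (1 - s) \<cdot>\<^sub>m (c * a) + of_real s \<cdot>\<^sub>m (a * c)"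

text \<open>This is the Bott index of the pair in the form of a winding number due to Exel and
  Loring. It is an integer whenever the curve avoids \<open>0\<close>, which holds for unitary matrices whose
  commutator has norm less than \<open>1\<close>.\<close>

definition bott :: "complex mat \<Rightarrow> complex mat \<Rightarrow> complex" where
  "bott a c = winding_number (\<lambda>s. det (comm_segment a c s)) 0"

lemma comm_segment_carrier [simp]:
  "a \<in> carrier_mat N N \<Longrightarrow> c \<in> carrier_mat N N \<Longrightarrow> comm_segment a c s \<in> carrier_mat N N"
  by (simp add: comm_segment_def)

lemma continuous_on_det:
  fixes M :: "'a :: topological_space \<Rightarrow> complex mat"
  assumes M: "\<And>x. x \<in> S \<Longrightarrow> M x \<in> carrier_mat N N"
    and cont: "\<And>i j. i < N \<Longrightarrow> j < N \<Longrightarrow> continuous_on S (\<lambda>x. M x $$ (i, j))"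
  shows "continuous_on S (\<lambda>x. det (M x))"
proof -
  have "continuous_on S (\<lambda>x. \<Sum>p\<in>{p. p permutes {0..<N}}. signof p * (\<Prod>i = 0..<N. M x $$ (i, p i)))"
    by (intro continuous_on_sum continuous_on_mult continuous_on_const continuous_on_prod cont)
      (auto dest: permutes_in_image)
  then show ?thesis
    by (rule continuous_on_eq) (simp add: det_def'[OF M])
qed

lemma comm_segment_loop:
  assumes "a \<in> carrier_mat N N" "c \<in> carrier_mat N N"
  shows "det (comm_segment a c 1) = det (comm_segment a c 0)"
proof -
  have "comm_segment a c 1 = a * c" "comm_segment a c 0 = c * a"
    using assms by (auto simp: comm_segment_def intro!: eq_matI)
  then show ?thesis using assms by (simp add: det_mult[of _ N])
qed

definition mat_segment :: "complex mat \<Rightarrow> complex mat \<Rightarrow> real \<Rightarrow> complex mat" where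
  "mat_segment a b r = of_real (1 - r) \<cdot>\<^sub>m a + of_real r \<cdot>\<^sub>m b"

lemma mat_segment_carrier [simp]:
  "a \<in> carrier_mat N N \<Longrightarrow> b \<in> carrier_mat N N \<Longrightarrow> mat_segment a b r \<in> carrier_mat N N"
  by (simp add: mat_segment_def)

lemma mat_segment_ends [simp]:
  assumes "a \<in> carrier_mat N N" "b \<in> carrier_mat N N"
  shows "mat_segment a b 0 = a" "mat_segment a b 1 = b"
  using assms by (auto simp: mat_segment_def intro!: eq_matI)

lemma mat_segment_minus:
  assumes "a \<in> carrier_mat N N" "b \<in> carrier_mat N N"
  shows "mat_segment a b r - a = of_real r \<cdot>\<^sub>m (b - a)"
  using assms by (intro eq_matI) (auto simp: mat_segment_def algebra_simps)

lemma mat_segment_opbound: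
  assumes "unitary_mat N a" "unitary_mat N b" "0 \<le> r" "r \<le> 1"
  shows "opbound N (mat_segment a b r) 1"
proof -
  note c = unitary_mat_carrier[OF assms(1)] unitary_mat_carrier[OF assms(2)]
  have "opbound N (mat_segment a b r) (cmod (of_real (1 - r)) * 1 + cmod (of_real r) * 1)"
    unfolding mat_segment_def
    by (intro opbound_add opbound_smult opbound_unitary assms) (use c in auto)
  moreover have "cmod (of_real (1 - r)) * 1 + cmod (of_real r) * 1 = 1"
    using assms(3,4) unfolding norm_of_real by simp
  ultimately show ?thesis by simp
qed

text \<open>\<open>AB - ab = A (B - b) + (A - a) b\<close>.\<close>

lemma product_perturbation:
  assumes a: "a \<in> carrier_mat N N" "unitary_mat N b" and A: "A \<in> carrier_mat N N" "B \<in> carrier_mat N N"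
    and A1: "opbound N A 1" and Aa: "opbound N (A - a) \<eta>" "opbound N (B - b) \<eta>" "0 \<le> \<eta>"
  shows "opbound N (A * B - a * b) (2 * \<eta>)"
proof -
  note b = unitary_mat_carrier[OF a(2)]
  have "A * B - a * b = A * (B - b) + (A - a) * b"
    using a b A by (simp add: mult_minus_distrib_mat[of _ N N _ N] minus_mult_distrib_mat[of _ N N _ _ N])
      (intro eq_matI, auto)
  moreover have "opbound N (A * (B - b) + (A - a) * b) (1 * \<eta> + \<eta>)"
    by (intro opbound_add opbound_mult[OF A1] opbound_unitary_mult_right Aa) (use a b A in auto)
  ultimately show ?thesis by simp
qed

lemma comm_segment_index:
  assumes "a \<in> carrier_mat N N" "c \<in> carrier_mat N N" "i < N" "j < N"
  shows "comm_segment a c s $$ (i, j) =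
    of_real (1 - s) * (c * a) $$ (i, j) + of_real s * (a * c) $$ (i, j)"
  using assms by (simp add: comm_segment_def)

text \<open>Moving both matrices along straight segments deforms one closed curve into the
  other. Every matrix that occurs on the way is within \<open>2\<eta> + \<delta> < 1\<close> of the unitary matrix \<open>ca\<close>, so its
  determinant does not vanish. The bound is independent of the size of the matrices, although the
  determinants themselves may vary wildly.\<close>

lemma bott_stable:
  assumes u: "unitary_mat N a" "unitary_mat N a'" "unitary_mat N c" "unitary_mat N c'"
    and close: "opbound N (a - a') \<eta>" "opbound N (c - c') \<eta>" "0 \<le> \<eta>"
    and comm: "opbound N (a * c - c * a) \<delta>" "0 \<le> \<delta>" and small: "2 * \<eta> + \<delta> < 1"
  shows "bott a c = bott a' c'"
proof -
  note car = unitary_mat_carrier[OF u(1)] unitary_mat_carrier[OF u(2)]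
    unitary_mat_carrier[OF u(3)] unitary_mat_carrier[OF u(4)]
  define A where "A = mat_segment a a'"
  define C where "C = mat_segment c c'"
  have AC: "A r \<in> carrier_mat N N" "C r \<in> carrier_mat N N" for r
    using car by (simp_all add: A_def C_def)
  have ends: "A 0 = a" "A 1 = a'" "C 0 = c" "C 1 = c'"
    using car by (simp_all add: A_def C_def)
  have seg: "opbound N (mat_segment x y r - x) \<eta>"
    if "opbound N (x - y) \<eta>" "x \<in> carrier_mat N N" "y \<in> carrier_mat N N" "r \<in> {0..1}" for x y r
  proof -
    have "opbound N (mat_segment x y r - x) (cmod (of_real r) * \<eta>)"
      unfolding mat_segment_minus[OF that(2,3)]
      using opbound_smult[OF opbound_minus_commute[OF that(1-3)], of "of_real r"] that by simp
    moreover have "cmod (of_real r) * \<eta> \<le> \<eta>"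
      using that(4) close(3) by (simp add: mult_left_le_one_le)
    ultimately show ?thesis by (rule opbound_mono)
  qed
  have nz: "det (comm_segment (A r) (C r) s) \<noteq> 0" if r: "r \<in> {0..1}" and s: "s \<in> {0..1}" for r s :: real
  proof (rule det_nonzero_near_unitary[OF unitary_mat_mult[OF u(3,1)]])
    have Ar: "opbound N (A r) 1" "opbound N (A r - a) \<eta>"
      unfolding A_def using r by (auto intro!: mat_segment_opbound u seg close(1) car)
    have Cr: "opbound N (C r) 1" "opbound N (C r - c) \<eta>"
      unfolding C_def using r by (auto intro!: mat_segment_opbound u seg close(2) car)
    have CA: "opbound N (C r * A r - c * a) (2 * \<eta>)"
      by (rule product_perturbation[OF car(3) u(1) AC(2,1) Cr Ar(2) close(3)])
    have ACp: "opbound N (A r * C r - a * c) (2 * \<eta>)"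
      by (rule product_perturbation[OF car(1) u(3) AC Ar Cr(2) close(3)])
    have "comm_segment (A r) (C r) s - c * a =
      of_real (1 - s) \<cdot>\<^sub>m (C r * A r - c * a) + of_real s \<cdot>\<^sub>m (A r * C r - a * c) + of_real s \<cdot>\<^sub>m (a * c - c * a)"
      using AC[of r] car
      by (intro eq_matI) (auto simp: comm_segment_index[of _ N] carrier_matD[OF AC(1)] carrier_matD[OF AC(2)] algebra_simps)
    moreover have "opbound N \<dots> (cmod (of_real (1 - s)) * (2 * \<eta>) + cmod (of_real s) * (2 * \<eta>) + cmod (of_real s) * \<delta>)"
      by (intro opbound_add opbound_smult CA ACp comm(1)) (use AC car in auto)
    ultimately show "opbound N (comm_segment (A r) (C r) s - c * a)
      (cmod (of_real (1 - s)) * (2 * \<eta>) + cmod (of_real s) * (2 * \<eta>) + cmod (of_real s) * \<delta>)" by simp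
    have "s * \<delta> \<le> \<delta>" using s comm(2) by (simp add: mult_left_le_one_le)
    then show "cmod (of_real (1 - s)) * (2 * \<eta>) + cmod (of_real s) * (2 * \<eta>) + cmod (of_real s) * \<delta> < 1"
      using s small unfolding norm_of_real by (simp add: algebra_simps)
  qed (use AC in auto)
  define H where "H = (\<lambda>(r, s). det (comm_segment (A r) (C r) s))"
  have "continuous_on ({0..1} \<times> {0..1}) H"
    unfolding H_def case_prod_unfold
  proof (rule continuous_on_det)
    fix i j assume ij: "i < N" "j < N"
    have "continuous_on ({0..1} \<times> {0..1})
      (\<lambda>x. of_real (1 - snd x) * (\<Sum>l<N. (of_real (1 - fst x) * c $$ (i, l) + of_real (fst x) * c' $$ (i, l)) *
            (of_real (1 - fst x) * a $$ (l, j) + of_real (fst x) * a' $$ (l, j))) +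
          of_real (snd x) * (\<Sum>l<N. (of_real (1 - fst x) * a $$ (i, l) + of_real (fst x) * a' $$ (i, l)) *
            (of_real (1 - fst x) * c $$ (l, j) + of_real (fst x) * c' $$ (l, j))))"
      by (intro continuous_intros)
    then show "continuous_on ({0..1} \<times> {0..1}) (\<lambda>x. comm_segment (A (fst x)) (C (fst x)) (snd x) $$ (i, j))"
    proof (rule continuous_on_eq)
      fix x :: "real \<times> real"
      show "of_real (1 - snd x) * (\<Sum>l<N. (of_real (1 - fst x) * c $$ (i, l) + of_real (fst x) * c' $$ (i, l)) *
            (of_real (1 - fst x) * a $$ (l, j) + of_real (fst x) * a' $$ (l, j))) +
          of_real (snd x) * (\<Sum>l<N. (of_real (1 - fst x) * a $$ (i, l) + of_real (fst x) * a' $$ (i, l)) *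
            (of_real (1 - fst x) * c $$ (l, j) + of_real (fst x) * c' $$ (l, j))) =
          comm_segment (A (fst x)) (C (fst x)) (snd x) $$ (i, j)"
      proof -
        have "(C (fst x) * A (fst x)) $$ (i, j) = (\<Sum>l<N. C (fst x) $$ (i, l) * A (fst x) $$ (l, j))"
          "(A (fst x) * C (fst x)) $$ (i, j) = (\<Sum>l<N. A (fst x) $$ (i, l) * C (fst x) $$ (l, j))"
          using index_mat_mult_sum[OF AC(2) AC(1) ij, of "fst x" "fst x"]
            index_mat_mult_sum[OF AC(1) AC(2) ij, of "fst x" "fst x"] by blast+
        then show ?thesis
          using ij car AC[of "fst x"]
          by (simp add: comm_segment_index[of _ N] A_def C_def mat_segment_def)
      qed
    qed
  qed (use AC in auto)
  then have "homotopic_loops (- {0}) (\<lambda>s. det (comm_segment a c s)) (\<lambda>s. det (comm_segment a' c' s))"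
    unfolding homotopic_loops
    by (intro exI[of _ H])
      (use nz comm_segment_loop[OF AC] in \<open>auto simp: H_def ends pathfinish_def pathstart_def\<close>)
  then show ?thesis unfolding bott_def by (rule winding_number_homotopic_loops)
qed

lemma det_unitary_nonzero:
  assumes U: "unitary_mat N U"
  shows "det U \<noteq> 0"
  by (rule det_nonzero_near_unitary[OF U _ opbound_self_minus[of U N 0]])
    (use unitary_mat_carrier[OF U] in simp_all)

lemma det_mat_diag: "det (mat_diag N g) = (\<Prod>i<N. g i :: complex)"
proof -
  have "det (mat_diag N g) = prod_list (diag_mat (mat_diag N g))"
    by (rule det_upper_triangular[of _ N]) (auto simp: mat_diag_def)
  also have "diag_mat (mat_diag N g) = map g [0..<N]"
    by (auto simp: diag_mat_def mat_diag_def)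
  also have "prod_list (map g [0..<N]) = (\<Prod>i<N. g i)"
    by (metis atLeast0LessThan prod.distinct_set_conv_list distinct_upt set_upt)
  finally show ?thesis .
qed

lemma det_diagonalized:
  assumes V: "unitary_mat N V" and A: "A \<in> carrier_mat N N" and AV: "A * V = V * mat_diag N g"
  shows "det A = (\<Prod>i<N. g i)"
proof -
  note Vc = unitary_mat_carrier[OF V]
  have "det V \<noteq> 0" by (rule det_unitary_nonzero[OF V])
  moreover have "det A * det V = det V * det (mat_diag N g)"
    using arg_cong[OF AV, of det] A Vc by (simp add: det_mult[of _ N])
  ultimately show ?thesis by (simp add: det_mat_diag)
qed

text \<open>After division by the constant \<open>det (ca)\<close>, the curve is
  \<open>det (1 + s (w - 1))\<close> with the unitary \<open>w = (ca)\<^sup>* ac\<close>. It is the product of the numbers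
  \<open>1 + s (d - 1)\<close> over the eigenvalues \<open>d\<close> of \<open>w\<close>; at most \<open>k\<close> of them differ from \<open>1\<close>, by \<open>\<eta>\<close> at most.
  So the curve stays within distance \<open>(1 + \<eta>)\<^sup>k - 1 < 1\<close> of \<open>1\<close> and does not wind around \<open>0\<close>.\<close>

lemma bott_eq_0_low_rank:
  assumes a: "unitary_mat N a" and c: "unitary_mat N c"
    and rk: "rank_le N (a * c - c * a) k" and small: "opbound N (a * c - c * a) \<eta>" "0 \<le> \<eta>" "(1 + \<eta>) ^ k < 2"
  shows "bott a c = 0"
proof -
  note ac = unitary_mat_carrier[OF a] unitary_mat_carrier[OF c]
  define u where "u = c * a"
  have u: "unitary_mat N u" unfolding u_def by (rule unitary_mat_mult[OF c a])
  note uc = unitary_mat_carrier[OF u]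
  define w where "w = adj u * (a * c)"
  have w: "unitary_mat N w" unfolding w_def by (intro unitary_mat_mult unitary_mat_adj a c u)
  note wc = unitary_mat_carrier[OF w]
  have uw: "u * w = a * c"
  proof -
    have "u * w = (u * adj u) * (a * c)" using uc ac by (simp add: w_def square_mat_assoc[of _ N])
    then show ?thesis using ac by (simp add: unitary_mat_right[OF u])
  qed
  have w1: "w - 1\<^sub>m N = adj u * (a * c - c * a)"
    using ac uc by (simp add: mult_minus_distrib_mat[of _ N N _ N] w_def unitary_mat_left[OF u] flip: u_def)
  obtain V d where V: "unitary_mat N V" and wV: "w * V = V * mat_diag N d"
    using unitary_diagonalizable[OF w] by blast
  note Vc = unitary_mat_carrier[OF V]
  have lin: "(1\<^sub>m N + t \<cdot>\<^sub>m (w - 1\<^sub>m N)) * V = V * mat_diag N (\<lambda>i. 1 + t * (d i - 1))" for t :: complex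
  proof -
    have "(1\<^sub>m N + t \<cdot>\<^sub>m (w - 1\<^sub>m N)) * V = V + t \<cdot>\<^sub>m (w * V - V)"
      using wc Vc by (simp add: add_mult_distrib_mat[of _ N N _ _ N]
          minus_mult_distrib_mat[of _ N N _ _ N] mult_smult_assoc_mat[of _ N N _ N])
    also have "\<dots> = V * mat_diag N (\<lambda>i. 1 + t * (d i - 1))"
      unfolding wV mat_diag_mult_right[OF Vc] using Vc by (intro eq_matI) (auto simp: algebra_simps)
    finally show ?thesis .
  qed
  have w1V: "(w - 1\<^sub>m N) * V = V * mat_diag N (\<lambda>i. d i - 1)"
    unfolding mat_diag_mult_right[OF Vc]
    using wc Vc by (simp add: minus_mult_distrib_mat[of _ N N _ _ N] wV mat_diag_mult_right[OF Vc])
      (intro eq_matI, auto simp: algebra_simps)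
  let ?S = "{i. i < N \<and> d i - 1 \<noteq> 0}"
  have "rank_le N (w - 1\<^sub>m N) k"
    unfolding w1 by (rule rank_le_mult_left[OF rk]) (use ac uc in auto)
  then have card: "card ?S \<le> k"
    by (intro card_nonzero_le_rank[OF V _ w1V]) (use wc in auto)
  have "opbound N (w - 1\<^sub>m N) \<eta>"
    unfolding w1 by (intro opbound_unitary_mult_left unitary_mat_adj u small) (use ac in auto)
  then have d1: "cmod (d i - 1) \<le> \<eta>" if "i < N" for i
    by (intro opbound_diagonalized[OF V _ w1V _ that]) (use wc in auto)
  have det_eq: "det (comm_segment a c s) = det u * (\<Prod>i\<in>?S. 1 + of_real s * (d i - 1))" for s
  proof -
    have "comm_segment a c s = u * (1\<^sub>m N + of_real s \<cdot>\<^sub>m (w - 1\<^sub>m N))"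
    proof -
      have "u * (1\<^sub>m N + of_real s \<cdot>\<^sub>m (w - 1\<^sub>m N)) = u + of_real s \<cdot>\<^sub>m (u * w - u)"
        using uc wc by (simp add: mult_add_distrib_mat[of _ N N _ N] mult_minus_distrib_mat[of _ N N _ N]
            mult_smult_distrib[of _ N N _ N])
      also have "\<dots> = comm_segment a c s"
        unfolding comm_segment_def uw[symmetric] u_def[symmetric] using uc wc by (intro eq_matI) (auto simp: algebra_simps)
      finally show ?thesis by simp
    qed
    then have "det (comm_segment a c s) = det u * (\<Prod>i<N. 1 + of_real s * (d i - 1))"
      using uc wc by (simp add: det_mult[of _ N] det_diagonalized[OF V _ lin])
    also have "(\<Prod>i<N. 1 + of_real s * (d i - 1)) = (\<Prod>i\<in>?S. 1 + of_real s * (d i - 1))"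
      by (rule prod.mono_neutral_right) auto
    finally show ?thesis .
  qed
  have du: "det u \<noteq> 0" by (rule det_unitary_nonzero[OF u])
  have close: "cmod ((\<Prod>i\<in>?S. 1 + of_real s * (d i - 1)) - 1) < 1" if s: "s \<in> {0..1}" for s :: real
  proof -
    have "cmod ((\<Prod>i\<in>?S. 1 + of_real s * (d i - 1)) - 1) \<le> (\<Prod>i\<in>?S. 1 + cmod (of_real s * (d i - 1))) - 1"
      by (rule norm_prod_minus1_le_prod_minus1)
    also have "(\<Prod>i\<in>?S. 1 + cmod (of_real s * (d i - 1))) \<le> (\<Prod>i\<in>?S. 1 + \<eta>)"
    proof (rule prod_mono)
      fix i assume i: "i \<in> ?S"
      have "\<bar>s\<bar> * cmod (d i - 1) \<le> 1 * \<eta>"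
        using s d1[of i] i by (intro mult_mono) auto
      then show "0 \<le> 1 + cmod (of_real s * (d i - 1)) \<and> 1 + cmod (of_real s * (d i - 1)) \<le> 1 + \<eta>"
        by (simp add: norm_mult)
    qed
    also have "(\<Prod>i\<in>?S. 1 + \<eta>) \<le> (1 + \<eta>) ^ k"
      using card small(2) by (simp add: power_increasing)
    also have "(1 + \<eta>) ^ k - 1 < 1" using small(3) by simp
    finally show ?thesis by simp
  qed
  have "winding_number (\<lambda>s. det (comm_segment a c s)) 0 = 0"
  proof (rule winding_number_zero_outside)
    show "path (\<lambda>s. det (comm_segment a c s))"
      unfolding path_def det_eq by (intro continuous_intros)
    show "pathfinish (\<lambda>s. det (comm_segment a c s)) = pathstart (\<lambda>s. det (comm_segment a c s))"
      using comm_segment_loop[OF ac] by (simp add: pathfinish_def pathstart_def)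
    show "path_image (\<lambda>s. det (comm_segment a c s)) \<subseteq> ball (det u) (cmod (det u))"
    proof
      fix y assume "y \<in> path_image (\<lambda>s. det (comm_segment a c s))"
      then obtain s where s: "s \<in> {0..1}" "y = det u * (\<Prod>i\<in>?S. 1 + of_real s * (d i - 1))"
        unfolding path_image_def det_eq by auto
      have "dist (det u) y = cmod (det u * ((\<Prod>i\<in>?S. 1 + of_real s * (d i - 1)) - 1))"
        unfolding s(2) dist_commute[of "det u"] by (simp add: dist_norm algebra_simps)
      also have "\<dots> < cmod (det u)"
        unfolding norm_mult using close[OF s(1)] du mult_strict_left_mono[of _ 1 "cmod (det u)"] by simp
      finally show "y \<in> ball (det u) (cmod (det u))" by simp
    qed
  qed auto
  then show ?thesis by (simp add: bott_def)
qed

text \<open>The \<open>n\<close>-th power of the chord from \<open>1\<close> to \<open>\<omega> = e\<^bsup>2\<pi>i/n\<^esup>\<close> goes once around the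
  origin: the chord can be deformed into the arc from \<open>1\<close> to \<open>\<omega>\<close>, whose \<open>n\<close>-th power is the unit
  circle. Before the power is taken, the deformed curves lie in the right half plane, since the angle
  \<open>2\<pi>/n\<close> is less than a right angle; this is where \<open>n \<ge> 5\<close> enters. The factor \<open>D\<close> is contracted to \<open>1\<close> at the same
  time.\<close>

lemma winding_number_polygon:
  assumes n: "5 \<le> n" and D: "D \<noteq> 0"
  shows "winding_number (\<lambda>s. D * (1 - of_real s + of_real s * cis (2 * pi / n)) ^ n) 0 = 1"
proof -
  obtain L where L: "D = exp L" using D by (metis exp_Ln)
  let ?w = "cis (2 * pi / n)"
  define h where "h = (\<lambda>(r :: real, s :: real). exp (of_real (1 - r) * L) *
     (of_real (1 - r) * (1 - of_real s + of_real s * ?w) + of_real r * exp (\<i> * of_real (2 * pi * s / n))) ^ n)"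
  have n0: "n > 0" using n by simp
  have "2 * pi / n < pi / 2" using n by (simp add: field_simps)
  then have cos_pos: "cos (2 * pi * s / n) > 0" if "s \<in> {0..1}" for s
  proof -
    have "2 * pi * s / n \<le> 2 * pi / n" using that n by (intro divide_right_mono) auto
    moreover have "0 \<le> 2 * pi * s / n" using that n by simp
    ultimately show ?thesis using \<open>2 * pi / n < pi / 2\<close> by (intro cos_gt_zero_pi) linarith+
  qed
  have ends: "exp (\<i> * of_real (2 * pi * 1 / n)) = ?w" by (simp add: cis_conv_exp)
  have wn: "?w ^ n = 1"
  proof -
    have "?w ^ n = cis (real n * (2 * pi / n))" by (rule Complex.DeMoivre)
    also have "real n * (2 * pi / n) = 2 * pi" using n0 by simp
    finally show ?thesis by simp
  qed
  have "homotopic_loops (- {0}) (\<lambda>s. D * (1 - of_real s + of_real s * ?w) ^ n) (\<lambda>s. exp (\<i> * of_real (2 * pi * s / n)) ^ n)"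
    unfolding homotopic_loops
  proof (intro exI[of _ h] conjI ballI)
    show "continuous_on ({0..1} \<times> {0..1}) h"
      unfolding h_def case_prod_unfold using n0 by (intro continuous_intros) auto
    show "h \<in> {0..1} \<times> {0..1} \<rightarrow> - {0}"
    proof (clarsimp simp: h_def)
      fix r s :: real assume r: "0 \<le> r" "r \<le> 1" and s: "0 \<le> s" "s \<le> 1"
        and z: "(1 - complex_of_real r) * (1 - complex_of_real s + complex_of_real s * ?w) +
           complex_of_real r * exp (\<i> * (2 * complex_of_real pi * complex_of_real s) / of_nat n) = 0"
      have c1: "cos (2 * pi / n) > 0" and cs: "cos (2 * pi * s / n) > 0" using cos_pos[of 1] cos_pos[of s] s by auto
      have e: "exp (\<i> * (2 * complex_of_real pi * complex_of_real s) / of_nat n) = cis (2 * pi * s / n)"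
        by (simp add: cis_conv_exp)
      have "0 = (1 - r) * (1 - s + s * cos (2 * pi / n)) + r * cos (2 * pi * s / n)"
        using arg_cong[OF z, of Re] unfolding e by simp
      moreover have "1 - s + s * cos (2 * pi / n) > 0"
        using c1 s by (cases "s = 1") (auto intro: add_pos_nonneg)
      then have "(1 - r) * (1 - s + s * cos (2 * pi / n)) + r * cos (2 * pi * s / n) > 0"
        using cs r by (cases "r = 1") (auto intro!: add_pos_nonneg)
      ultimately show False by simp
    qed
    fix r :: real assume "r \<in> {0..1}"
    show "pathfinish (h \<circ> Pair r) = pathstart (h \<circ> Pair r)"
    proof -
      have "of_real (1 - r) * ?w + of_real r * ?w = ?w" by (simp add: algebra_simps)
      then show ?thesis using wn ends by (simp add: h_def pathfinish_def pathstart_def)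
    qed
  qed (auto simp: h_def L)
  then have "winding_number (\<lambda>s. D * (1 - of_real s + of_real s * ?w) ^ n) 0 =
      winding_number (\<lambda>s. exp (\<i> * of_real (2 * pi * s / n)) ^ n) 0"
    by (rule winding_number_homotopic_loops)
  also have "(\<lambda>s. exp (\<i> * of_real (2 * pi * s / n)) ^ n) = circlepath 0 1"
  proof
    fix s :: real
    have "exp (\<i> * of_real (2 * pi * s / n)) ^ n = exp (of_nat n * (\<i> * of_real (2 * pi * s / n)))"
      by (rule exp_of_nat_mult[symmetric])
    also have "of_nat n * (\<i> * of_real (2 * pi * s / n)) = 2 * of_real pi * \<i> * of_real s"
      using n0 by simp
    also have "exp (2 * of_real pi * \<i> * of_real s) = circlepath 0 1 s"
      by (simp add: circlepath)
    finally show "exp (\<i> * of_real (2 * pi * s / n)) ^ n = circlepath 0 1 s" .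
  qed
  also have "winding_number (circlepath 0 1) 0 = 1" by (simp add: winding_number_circlepath_centre)
  finally show ?thesis .
qed

lemma bott_eq_1:
  assumes a: "unitary_mat N a" and c: "unitary_mat N c" and n: "5 \<le> n" "n \<le> N"
    and ac: "a * c = c * a * mat_diag N (\<lambda>i. if i < n then cis (2 * pi / n) else 1)"
  shows "bott a c = 1"
proof -
  note acc = unitary_mat_carrier[OF a] unitary_mat_carrier[OF c]
  have u: "unitary_mat N (c * a)" by (rule unitary_mat_mult[OF c a])
  note uc = unitary_mat_carrier[OF u]
  let ?w = "cis (2 * pi / n)"
  have "det (comm_segment a c s) = det (c * a) * (1 - of_real s + of_real s * ?w) ^ n" for s
  proof -
    let ?g = "\<lambda>i. if i < n then 1 - of_real s + of_real s * ?w else 1"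
    have "comm_segment a c s = (c * a) * mat_diag N ?g"
      unfolding comm_segment_def ac mat_diag_mult_right[OF uc]
      using carrier_matD[OF uc] by (intro eq_matI) (auto simp: algebra_simps)
    then have "det (comm_segment a c s) = det (c * a) * det (mat_diag N ?g)"
      using uc by (simp add: det_mult[of _ N])
    also have "det (mat_diag N ?g) = (\<Prod>i<N. ?g i)"
      by (rule det_mat_diag)
    also have "\<dots> = (\<Prod>i<n. ?g i)"
      by (rule prod.mono_neutral_right) (use n in auto)
    finally show ?thesis by simp
  qed
  moreover have "det (c * a) \<noteq> 0"
    by (rule det_unitary_nonzero[OF u])
  ultimately show ?thesis using winding_number_polygon[OF n(1)] by (simp add: bott_def)
qed

section \<open>Vanishing of the Bott index for products of reflections\<close>

lemma rank_le_minus: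
  assumes "rank_le N A k" "rank_le N B l" "A \<in> carrier_mat N N" "B \<in> carrier_mat N N"
  shows "rank_le N (A - B) (k + l)"
proof -
  have "A - B = A + ((-1) \<cdot>\<^sub>m 1\<^sub>m N) * B"
    using assms by (simp add: minus_mat_eq mult_smult_assoc_mat[of _ N N _ N])
  then show ?thesis
    using rank_le_add[OF assms(1) rank_le_mult_left[OF assms(2,4), of "(-1) \<cdot>\<^sub>m 1\<^sub>m N"]] assms
    by simp
qed

text \<open>\<open>a\<^sup>* - b\<^sup>* = a\<^sup>* (b - a) b\<^sup>*\<close>.\<close>

lemma opbound_adj_minus:
  assumes a: "unitary_mat N a" and b: "unitary_mat N b" and ab: "opbound N (a - b) C" "0 \<le> C"
  shows "opbound N (adj a - adj b) C"
proof -
  note c = unitary_mat_carrier[OF a] unitary_mat_carrier[OF b]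
  have "adj a * ((b - a) * adj b) = adj a * (b * adj b) - (adj a * a) * adj b"
    using c by (simp add: minus_mult_distrib_mat[of _ N N _ _ N] mult_minus_distrib_mat[of _ N N _ N]
        square_mat_assoc[of _ N])
  also have "\<dots> = adj a - adj b"
    using c by (simp add: unitary_mat_right[OF b] unitary_mat_left[OF a])
  finally show ?thesis
    using opbound_unitary_mult_left[OF unitary_mat_adj[OF a]
        opbound_unitary_mult_right[OF unitary_mat_adj[OF b] opbound_minus_commute[OF ab(1)]]] c ab(2)
    by simp
qed

text \<open>Let \<open>q\<close> and \<open>p\<close> be the corrected involutions near \<open>b\<close> and \<open>ab\<close>. Then
  \<open>a = (ab) b\<^sup>*\<close> is close to \<open>a' = p q\<^sup>*\<close>, and \<open>a' - 1 = ((p - 1) - (q - 1)) q\<^sup>*\<close> has rank at most \<open>2n\<close>.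
  So \<open>a'c - ca' = (a' - 1) c - c (a' - 1)\<close> has rank at most \<open>4n\<close>, independently of \<open>N\<close>.\<close>

lemma bott_eq_0_of_reflections:
  assumes u: "unitary_mat N a" "unitary_mat N b" "unitary_mat N c"
    and b2: "opbound N (b * b - 1\<^sub>m N) \<eta>" and ab2: "opbound N ((a * b) * (a * b) - 1\<^sub>m N) \<eta>"
    and comm: "opbound N (a * c - c * a) \<theta>" and pos: "0 \<le> \<eta>" "0 \<le> \<theta>"
    and near: "near_one_off N b n (1/2)" "near_one_off N (a * b) n (1/2)"
    and small: "4 * \<eta> + \<theta> < 1" "(1 + (4 * \<eta> + \<theta>)) ^ (4 * n) < 2"
  shows "bott a c = 0"
proof -
  note car = unitary_mat_carrier[OF u(1)] unitary_mat_carrier[OF u(2)] unitary_mat_carrier[OF u(3)]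
  have y: "unitary_mat N (a * b)" by (rule unitary_mat_mult[OF u(1,2)])
  obtain q where q: "unitary_mat N q" "opbound N (b - q) \<eta>" "rank_le N (q - 1\<^sub>m N) n"
    using almost_involution_correction[OF u(2) b2 near(1)] by auto
  obtain p where p: "unitary_mat N p" "opbound N (a * b - p) \<eta>" "rank_le N (p - 1\<^sub>m N) n"
    using almost_involution_correction[OF y ab2 near(2)] by auto
  note pq = unitary_mat_carrier[OF p(1)] unitary_mat_carrier[OF q(1)]
  define a' where "a' = p * adj q"
  have a': "unitary_mat N a'" unfolding a'_def by (intro unitary_mat_mult unitary_mat_adj p q)
  note a'c = unitary_mat_carrier[OF a']
  have "a = (a * b) * adj b" using car by (simp add: square_mat_assoc[of _ N] unitary_mat_right[OF u(2)])
  then have aa': "opbound N (a - a') (2 * \<eta>)"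
    using product_perturbation[OF pq(1) unitary_mat_adj[OF q(1)] _ _ opbound_unitary[OF y] p(2)
        opbound_adj_minus[OF u(2) q(1,2) pos(1)] pos(1)] car
    by (simp add: a'_def)
  have "rank_le N (a' - 1\<^sub>m N) (n + n)"
  proof -
    have "((p - 1\<^sub>m N) - (q - 1\<^sub>m N)) * adj q = p * adj q - q * adj q"
    proof -
      have "(p - 1\<^sub>m N) - (q - 1\<^sub>m N) = p - q" using pq by (intro eq_matI) auto
      then show ?thesis using pq by (simp add: minus_mult_distrib_mat[of _ N N _ _ N])
    qed
    then show ?thesis
      using rank_le_mult_right[OF rank_le_minus[OF p(3) q(3)], of "adj q"] pq
      by (simp add: a'_def unitary_mat_right[OF q(1)])
  qed
  then have "rank_le N ((a' - 1\<^sub>m N) * c - c * (a' - 1\<^sub>m N)) ((n + n) + (n + n))"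
    using rank_le_minus[OF rank_le_mult_right rank_le_mult_left] a'c car by simp
  moreover have "(a' - 1\<^sub>m N) * c - c * (a' - 1\<^sub>m N) = a' * c - c * a'"
  proof -
    have "(a' - 1\<^sub>m N) * c = a' * c - c" "c * (a' - 1\<^sub>m N) = c * a' - c"
      using a'c car by (simp_all add: minus_mult_distrib_mat[of _ N N _ _ N] mult_minus_distrib_mat[of _ N N _ N])
    then show ?thesis using a'c car by (auto intro!: eq_matI)
  qed
  ultimately have rk: "rank_le N (a' * c - c * a') (4 * n)" by (simp add: numeral_eq_Suc add.assoc)
  have "a' * c - c * a' = (a' - a) * c + (a * c - c * a) + c * (a - a')"
  proof -
    have "(a' - a) * c = a' * c - a * c" "c * (a - a') = c * a - c * a'"
      using a'c car by (simp_all add: minus_mult_distrib_mat[of _ N N _ _ N] mult_minus_distrib_mat[of _ N N _ N])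
    then show ?thesis using a'c car by (auto intro!: eq_matI)
  qed
  moreover have "opbound N ((a' - a) * c + (a * c - c * a) + c * (a - a')) (2 * \<eta> + \<theta> + 2 * \<eta>)"
    using opbound_add[OF opbound_add[OF opbound_unitary_mult_right[OF u(3) opbound_minus_commute[OF aa']] comm]
        opbound_unitary_mult_left[OF u(3) aa']] a'c car pos(1) by simp
  ultimately have "opbound N (a' * c - c * a') (4 * \<eta> + \<theta>)" by simp
  then have "bott a' c = 0"
    by (rule bott_eq_0_low_rank[OF a' u(3) rk]) (use pos small in auto)
  moreover have "bott a c = bott a' c"
    by (rule bott_stable[OF u(1) a' u(3,3) aa' opbound_self_minus[OF car(3)] _ comm])
      (use pos small in auto)
  ultimately show ?thesis by simp
qed

text \<open>Formal inverses are represented by unitary matrices \<open>a'\<close> and \<open>c'\<close> of their own, which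
  are only close to the adjoints. Multiplying \<open>a c a' c'\<close> by \<open>ca\<close> on the right gives a matrix close
  to \<open>ca\<close> by the relation, and close to \<open>ac\<close> by cancelling \<open>c' c\<close> and then \<open>a' a\<close>.\<close>

lemma opbound_commutator:
  assumes u: "unitary_mat N a" "unitary_mat N c" "unitary_mat N a'" "unitary_mat N c'"
    and rel: "opbound N (a * (c * (a' * c')) - 1\<^sub>m N) \<delta>"
    and inv: "opbound N (a' * a - 1\<^sub>m N) \<delta>" "opbound N (c' * c - 1\<^sub>m N) \<delta>" and pos: "0 \<le> \<delta>"
  shows "opbound N (a * c - c * a) (3 * \<delta>)"
proof -
  note car = unitary_mat_carrier[OF u(1)] unitary_mat_carrier[OF u(2)]
    unitary_mat_carrier[OF u(3)] unitary_mat_carrier[OF u(4)]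
  define X where "X = a' * ((c' * c - 1\<^sub>m N) * a) + (a' * a - 1\<^sub>m N)"
  have X: "X = a' * (c' * (c * a)) - 1\<^sub>m N"
  proof -
    have "a' * ((c' * c - 1\<^sub>m N) * a) = a' * (c' * (c * a)) - a' * a"
      using car by (simp add: minus_mult_distrib_mat[of _ N N _ _ N] mult_minus_distrib_mat[of _ N N _ N]
          square_mat_assoc[of _ N])
    then show ?thesis unfolding X_def using car by (auto intro!: eq_matI)
  qed
  have Xb: "opbound N X (2 * \<delta>)"
    unfolding X_def
    using opbound_add[OF opbound_unitary_mult_left[OF u(3) opbound_unitary_mult_right[OF u(1) inv(2)]] inv(1)]
      car pos by simp
  have Xc: "X \<in> carrier_mat N N" using car by (simp add: X)
  have "opbound N ((a * (c * (a' * c')) - 1\<^sub>m N) * (c * a) - (a * c) * X) (\<delta> + 2 * \<delta>)"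
    using opbound_minus[OF opbound_unitary_mult_right[OF unitary_mat_mult[OF u(2,1)] rel]
        opbound_unitary_mult_left[OF unitary_mat_mult[OF u(1,2)] Xb Xc]] Xc car pos
    by simp
  moreover have "(a * (c * (a' * c')) - 1\<^sub>m N) * (c * a) - (a * c) * X = a * c - c * a"
  proof -
    have "(a * (c * (a' * c')) - 1\<^sub>m N) * (c * a) = a * (c * (a' * (c' * (c * a)))) - c * a"
      using car by (simp add: minus_mult_distrib_mat[of _ N N _ _ N] square_mat_assoc[of _ N])
    moreover have "(a * c) * X = a * (c * (a' * (c' * (c * a)))) - a * c"
      unfolding X using car by (simp add: mult_minus_distrib_mat[of _ N N _ N] square_mat_assoc[of _ N])
    ultimately show ?thesis using car by (auto intro!: eq_matI)
  qed
  ultimately show ?thesis by simp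
qed

section \<open>Finite corners of matrices in the direct limit\<close>

text \<open>The passage to \<open>N \<times> N\<close> matrices, on which determinants and eigenvectors are available.
  On matrices that agree with the unit matrix outside the corner it loses nothing.\<close>

definition corner :: "nat \<Rightarrow> cmat \<Rightarrow> complex mat" where
  "corner N u = mat N N (\<lambda>(i, j). u i j)"

definition one_off_corner :: "nat \<Rightarrow> cmat \<Rightarrow> bool" where
  "one_off_corner N u \<longleftrightarrow> (\<forall>i j. N \<le> i \<or> N \<le> j \<longrightarrow> u i j = mat_one i j)"

lemma corner_carrier [simp]: "corner N u \<in> carrier_mat N N"
  by (simp add: corner_def)

lemma corner_mat_one [simp]: "corner N mat_one = 1\<^sub>m N"
  by (rule eq_matI) (auto simp: corner_def mat_one_def)

lemma one_off_corner_mat_one [simp]: "one_off_corner N mat_one"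
  by (simp add: one_off_corner_def)

lemma corner_inject:
  assumes "one_off_corner N u" "one_off_corner N v" "corner N u = corner N v"
  shows "u = v"
proof (intro ext)
  fix i j
  show "u i j = v i j"
  proof (cases "i < N \<and> j < N")
    case True
    then show ?thesis using arg_cong[OF assms(3), of "\<lambda>A. A $$ (i, j)"] by (simp add: corner_def)
  next
    case False
    then show ?thesis using assms(1,2) by (auto simp: one_off_corner_def)
  qed
qed

lemma mat_mult_corner:
  assumes u: "one_off_corner N u" and v: "one_off_corner N v"
  shows "mat_mult u v i j = (if i < N \<and> j < N then (\<Sum>k<N. u i k * v k j) else mat_one i j)"
proof (cases "i < N \<and> j < N")
  case True
  have "u i k * v k j = 0" if "k \<notin> {..<N}" for k
    using True that u by (simp add: one_off_corner_def mat_one_def)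
  then show ?thesis using True suminf_finite[of "{..<N}" "\<lambda>k. u i k * v k j"] by (simp add: mat_mult_def)
next
  case False
  have "u i k * v k j = (if k = i then mat_one i j else 0)" for k
    using False u v by (cases "k < N") (auto simp: one_off_corner_def mat_one_def)
  then show ?thesis using False suminf_finite[of "{i}" "\<lambda>k. u i k * v k j"] by (auto simp: mat_mult_def)
qed

lemma one_off_corner_mult:
  "one_off_corner N u \<Longrightarrow> one_off_corner N v \<Longrightarrow> one_off_corner N (mat_mult u v)"
  by (auto simp: one_off_corner_def[of N "mat_mult u v"] mat_mult_corner)

lemma corner_mult:
  assumes "one_off_corner N u" "one_off_corner N v"
  shows "corner N (mat_mult u v) = corner N u * corner N v"
proof (rule eq_matI)
  fix i j assume "i < dim_row (corner N u * corner N v)" "j < dim_col (corner N u * corner N v)"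
  then have ij: "i < N" "j < N" by (auto simp: corner_def)
  then have "(corner N u * corner N v) $$ (i, j) = (\<Sum>k<N. u i k * v k j)"
    by (subst index_mat_mult_sum[OF corner_carrier corner_carrier]) (auto simp: corner_def)
  then show "corner N (mat_mult u v) $$ (i, j) = (corner N u * corner N v) $$ (i, j)"
    using ij by (simp add: corner_def mat_mult_corner[OF assms])
qed (auto simp: corner_def)

lemma one_off_corner_adj: "one_off_corner N u \<Longrightarrow> one_off_corner N (mat_adj u)"
  by (auto simp: one_off_corner_def mat_adj_def mat_one_def)

lemma corner_adj: "corner N (mat_adj u) = adj (corner N u)"
  by (rule eq_matI) (auto simp: corner_def mat_adj_def adj_def)

lemma U_fin_iff: "u \<in> U_fin N \<longleftrightarrow> one_off_corner N u \<and> unitary_mat N (corner N u)"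
proof
  assume u: "u \<in> U_fin N"
  then have o: "one_off_corner N u" by (auto simp: U_fin_def one_off_corner_def)
  have "adj (corner N u) * corner N u = corner N (mat_mult (mat_adj u) u)"
    by (simp add: corner_mult one_off_corner_adj o corner_adj)
  then show "one_off_corner N u \<and> unitary_mat N (corner N u)"
    using u o by (simp add: U_fin_def unitary_mat_def)
next
  assume "one_off_corner N u \<and> unitary_mat N (corner N u)"
  then have o: "one_off_corner N u" and U: "unitary_mat N (corner N u)" by auto
  have "mat_mult (mat_adj u) u = mat_one" "mat_mult u (mat_adj u) = mat_one"
    by (rule corner_inject[of N];
        simp add: one_off_corner_mult one_off_corner_adj o corner_mult corner_adj
          unitary_mat_left[OF U] unitary_mat_right[OF U])+
  then show "u \<in> U_fin N" using o by (simp add: U_fin_def one_off_corner_def)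
qed

lemma U_fin_mono: "u \<in> U_fin N \<Longrightarrow> N \<le> M \<Longrightarrow> u \<in> U_fin M"
  by (auto simp: U_fin_def)

lemma U_fin_mult: "u \<in> U_fin N \<Longrightarrow> v \<in> U_fin N \<Longrightarrow> mat_mult u v \<in> U_fin N"
  by (simp add: U_fin_iff one_off_corner_mult corner_mult unitary_mat_mult)

lemma U_fin_one: "mat_one \<in> U_fin N"
  by (simp add: U_fin_iff unitary_mat_one)

lemma vec_norm_eq_vnorm:
  assumes "\<And>i. N \<le> i \<Longrightarrow> x i = 0"
  shows "vec_norm x = vnorm (vec N x)"
proof -
  have "(\<Sum>i. (cmod (x i))\<^sup>2) = (\<Sum>i<N. (cmod (x i))\<^sup>2)"
    by (rule suminf_finite) (use assms in auto)
  then show ?thesis by (simp add: vec_norm_def vnorm_def L2_set_def)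
qed

lemma vnorm_vec_le_vec_norm:
  assumes "finite {i. x i \<noteq> 0}"
  shows "vnorm (vec N x) \<le> vec_norm x"
proof -
  have "summable (\<lambda>i. (cmod (x i))\<^sup>2)"
    by (rule summable_finite[OF assms]) auto
  then have "(\<Sum>i<N. (cmod (x i))\<^sup>2) \<le> (\<Sum>i. (cmod (x i))\<^sup>2)"
    by (rule sum_le_suminf) auto
  then show ?thesis by (simp add: vec_norm_def vnorm_def L2_set_def)
qed

lemma vec_norm_mat_apply:
  assumes u: "one_off_corner N u" and v: "one_off_corner N v"
  shows "vec_norm (mat_apply (mat_diff u v) x) = vnorm ((corner N u - corner N v) *\<^sub>v vec N x)"
proof -
  have D: "mat_diff u v i j = 0" if "N \<le> i \<or> N \<le> j" for i j
    using that u v by (auto simp: mat_diff_def one_off_corner_def)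
  have ap: "mat_apply (mat_diff u v) x i = (\<Sum>j<N. mat_diff u v i j * x j)" for i
    unfolding mat_apply_def by (rule suminf_finite) (use D in auto)
  have "vec N (mat_apply (mat_diff u v) x) = (corner N u - corner N v) *\<^sub>v vec N x"
  proof (rule eq_vecI)
    fix i assume "i < dim_vec ((corner N u - corner N v) *\<^sub>v vec N x)"
    then have i: "i < N" by (simp add: corner_def)
    show "vec N (mat_apply (mat_diff u v) x) $ i = ((corner N u - corner N v) *\<^sub>v vec N x) $ i"
      using i by (subst index_mult_mat_vec_sum[of _ N N]) (auto simp: ap, auto simp: mat_diff_def corner_def)
  qed (simp add: corner_def)
  then show ?thesis
    using vec_norm_eq_vnorm[of N "mat_apply (mat_diff u v) x"] D by (simp add: ap)
qed

text \<open>Vectors supported in the corner can be normalized to competitors in the supremum.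
  The supremum exists because \<open>2\<close> bounds the difference of two unitary matrices.\<close>

lemma op_norm_le_iff:
  assumes u: "u \<in> U_fin N" and v: "v \<in> U_fin N" and C: "0 \<le> C"
  shows "op_norm (mat_diff u v) \<le> C \<longleftrightarrow> opbound N (corner N u - corner N v) C"
proof -
  let ?B = "{x :: nat \<Rightarrow> complex. finite {i. x i \<noteq> 0} \<and> vec_norm x \<le> 1}"
  let ?D = "corner N u - corner N v"
  have o: "one_off_corner N u" "one_off_corner N v" using u v by (auto simp: U_fin_iff)
  note ap = vec_norm_mat_apply[OF o]
  have le: "vnorm (?D *\<^sub>v vec N x) \<le> K" if "opbound N ?D K" "0 \<le> K" "x \<in> ?B" for K x
  proof -
    have "vnorm (?D *\<^sub>v vec N x) \<le> K * vnorm (vec N x)" using that by (auto simp: opbound_def)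
    also have "\<dots> \<le> K * 1"
      using vnorm_vec_le_vec_norm[of x N] that by (intro mult_left_mono) auto
    finally show ?thesis by simp
  qed
  have zero: "(\<lambda>i. 0) \<in> ?B" by (simp add: vec_norm_def)
  have "opbound N ?D (1 + 1)"
    by (intro opbound_minus opbound_unitary) (use u v in \<open>auto simp: U_fin_iff\<close>)
  then have bdd: "bdd_above ((\<lambda>x. vnorm (?D *\<^sub>v vec N x)) ` ?B)"
    using le[of "1 + 1"] by (auto intro!: bdd_aboveI[of _ "1 + 1"])
  show ?thesis
  proof
    assume D: "opbound N ?D C"
    show "op_norm (mat_diff u v) \<le> C"
      unfolding op_norm_def ap
    proof (rule cSUP_least)
      show "?B \<noteq> {}" by (rule ex_in_conv[THEN iffD1, OF exI, OF zero])
      show "vnorm (?D *\<^sub>v vec N x) \<le> C" if "x \<in> ?B" for x by (rule le[OF D C that])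
    qed
  next
    assume le_C: "op_norm (mat_diff u v) \<le> C"
    show "opbound N ?D C"
      unfolding opbound_def
    proof
      fix w :: "complex vec" assume w: "w \<in> carrier_vec N"
      show "vnorm (?D *\<^sub>v w) \<le> C * vnorm w"
      proof (cases "w = 0\<^sub>v N")
        case True
        then show ?thesis using vnorm_zero[of N]
          by (metis (no_types, lifting) \<open>opbound N ?D (1 + 1)\<close> mult_zero_right opbound_def w)
      next
        case False
        then have p: "vnorm w > 0" using vnorm_pos[OF w] by simp
        define x where "x i = (if i < N then (of_real (1 / vnorm w) \<cdot>\<^sub>v w) $ i else 0)" for i
        have x: "vec N x = of_real (1 / vnorm w) \<cdot>\<^sub>v w"
          using w by (intro eq_vecI) (auto simp: x_def)
        have "vec_norm x = 1"
          using vec_norm_eq_vnorm[of N x] p unfolding x by (simp add: x_def vnorm_smult norm_divide)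
        moreover have "finite {i. x i \<noteq> 0}"
          by (rule finite_subset[of _ "{..<N}"]) (auto simp: x_def)
        ultimately have "x \<in> ?B" by simp
        then have "vnorm (?D *\<^sub>v vec N x) \<le> op_norm (mat_diff u v)"
          unfolding op_norm_def ap by (rule cSUP_upper[OF _ bdd])
        then have "vnorm (of_real (1 / vnorm w) \<cdot>\<^sub>v (?D *\<^sub>v w)) \<le> C"
          using le_C w unfolding x by (simp add: mult_mat_vec[of _ N N])
        then show ?thesis using p by (simp add: vnorm_smult norm_divide field_simps)
      qed
    qed
  qed
qed

section \<open>Voiculescu unitaries with a reflection\<close>

definition monomial_mat :: "(nat \<Rightarrow> nat) \<Rightarrow> (nat \<Rightarrow> complex) \<Rightarrow> cmat" where
  "monomial_mat f \<alpha> = (\<lambda>i j. if i = f j then \<alpha> j else 0)"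

lemma mat_mult_monomial:
  "mat_mult (monomial_mat f \<alpha>) (monomial_mat g \<beta>) = monomial_mat (f \<circ> g) (\<lambda>j. \<alpha> (g j) * \<beta> j)"
proof (intro ext)
  fix i j
  have "(\<Sum>k. monomial_mat f \<alpha> i k * monomial_mat g \<beta> k j) =
      (\<Sum>k\<in>{g j}. monomial_mat f \<alpha> i k * monomial_mat g \<beta> k j)"
    by (rule suminf_finite) (auto simp: monomial_mat_def)
  then show "mat_mult (monomial_mat f \<alpha>) (monomial_mat g \<beta>) i j =
      monomial_mat (f \<circ> g) (\<lambda>j. \<alpha> (g j) * \<beta> j) i j"
    by (simp add: mat_mult_def monomial_mat_def)
qed

lemma mat_one_monomial: "mat_one = monomial_mat id (\<lambda>j. 1)"
  by (auto simp: mat_one_def monomial_mat_def)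

lemma monomial_U_fin:
  assumes fg: "\<And>j. f (g j) = j" "\<And>j. g (f j) = j" and \<alpha>: "\<And>j. cmod (\<alpha> j) = 1"
    and off: "\<And>j. n \<le> j \<Longrightarrow> f j = j \<and> \<alpha> j = 1"
  shows "monomial_mat f \<alpha> \<in> U_fin n"
proof -
  have c: "cnj (\<alpha> j) * \<alpha> j = 1" "\<alpha> j * cnj (\<alpha> j) = 1" for j
    using \<alpha>[of j] complex_norm_square[of "\<alpha> j"] by (simp_all add: mult.commute)
  have "mat_adj (monomial_mat f \<alpha>) = monomial_mat g (\<lambda>j. cnj (\<alpha> (g j)))"
    using fg by (intro ext) (auto simp: mat_adj_def monomial_mat_def)
  moreover have "f \<circ> g = id" "g \<circ> f = id" using fg by auto
  moreover have "monomial_mat f \<alpha> i j = mat_one i j" if "n \<le> i \<or> n \<le> j" for i j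
    using that off[of i] off[of j] fg by (auto simp: monomial_mat_def mat_one_def) metis+
  ultimately show ?thesis
    by (simp add: U_fin_def mat_mult_monomial mat_one_monomial fg c)
qed

definition shift :: "nat \<Rightarrow> nat \<Rightarrow> nat" where
  "shift n j = (if j < n then (if Suc j = n then 0 else Suc j) else j)"

definition unshift :: "nat \<Rightarrow> nat \<Rightarrow> nat" where
  "unshift n j = (if j < n then (if j = 0 then n - 1 else j - 1) else j)"

definition reflect :: "nat \<Rightarrow> nat \<Rightarrow> nat" where
  "reflect n j = (if 0 < j \<and> j < n then n - j else j)"

definition clock :: "nat \<Rightarrow> nat \<Rightarrow> complex" where
  "clock n j = (if j < n then cis (2 * pi * j / n) else 1)"

lemma shift_unshift [simp]: "shift n (unshift n j) = j" "unshift n (shift n j) = j"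
  by (auto simp: shift_def unshift_def)

lemma reflect_reflect [simp]: "reflect n (reflect n j) = j"
  by (auto simp: reflect_def)

lemma cmod_clock [simp]: "cmod (clock n j) = 1"
  by (simp add: clock_def)

lemma clock_cnj [simp]: "clock n j * cnj (clock n j) = 1" "cnj (clock n j) * clock n j = 1"
  using complex_norm_square[of "clock n j"] by (simp_all add: mult.commute)

lemma clock_reflect: "clock n (reflect n j) = cnj (clock n j)"
proof (cases "0 < j \<and> j < n")
  case True
  have "cis (2 * pi * real (n - j) / n) = cis (2 * pi - 2 * pi * real j / n)"
    using True by (simp add: of_nat_diff field_simps)
  also have "\<dots> = cis (- (2 * pi * real j / n))"
    by (simp add: cis.ctr cos_diff sin_diff)
  finally show ?thesis using True by (simp add: reflect_def clock_def cis_cnj)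
qed (auto simp: reflect_def clock_def)

lemma clock_shift: "clock n (shift n j) = (if j < n then cis (2 * pi / n) else 1) * clock n j"
proof (cases "j < n")
  case True
  have eq: "cis (2 * pi / n) * cis (2 * pi * real j / n) = cis (2 * pi * real (Suc j) / n)"
    by (simp add: cis_mult add_divide_distrib[symmetric] algebra_simps)
  show ?thesis
  proof (cases "Suc j = n")
    case True
    then have "cis (2 * pi * real (Suc j) / n) = 1" by (simp del: of_nat_Suc)
    then show ?thesis using True eq by (simp add: shift_def clock_def)
  next
    case False
    then show ?thesis using \<open>j < n\<close> eq by (simp add: shift_def clock_def)
  qed
qed (simp add: shift_def clock_def)

text \<open>On the basis indexed by \<open>\<int>/n\<close>, the generator \<open>a\<close> multiplies by \<open>\<omega>\<^sup>j\<close> with \<open>\<omega> = e\<^bsup>2\<pi>i/n\<^esup>\<close>, and \<open>b\<close> and \<open>c\<close>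
  act as \<open>j \<mapsto> -j\<close> and \<open>j \<mapsto> j + 1\<close>. Negation inverts \<open>a\<close> exactly, while the shift commutes with \<open>a\<close>
  up to the factor \<open>\<omega>\<close>.\<close>

fun voiculescu_rep :: "nat \<Rightarrow> gen letter \<Rightarrow> cmat" where
  "voiculescu_rep n (Gen gen_a) = monomial_mat id (clock n)"
| "voiculescu_rep n (Inv gen_a) = monomial_mat id (\<lambda>j. cnj (clock n j))"
| "voiculescu_rep n (Gen gen_b) = monomial_mat (reflect n) (\<lambda>j. 1)"
| "voiculescu_rep n (Inv gen_b) = monomial_mat (reflect n) (\<lambda>j. 1)"
| "voiculescu_rep n (Gen gen_c) = monomial_mat (shift n) (\<lambda>j. 1)"
| "voiculescu_rep n (Inv gen_c) = monomial_mat (unshift n) (\<lambda>j. 1)"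

lemma letter_gen_cases:
  obtains "x = Gen gen_a" | "x = Inv gen_a" | "x = Gen gen_b" | "x = Inv gen_b" | "x = Gen gen_c" | "x = Inv gen_c"
proof (cases x)
  case (Gen g)
  then show ?thesis using that by (cases g) auto
next
  case (Inv g)
  then show ?thesis using that by (cases g) auto
qed

lemma voiculescu_rep_U_fin: "voiculescu_rep n x \<in> U_fin n"
proof -
  have "monomial_mat id (clock n) \<in> U_fin n" "monomial_mat id (\<lambda>j. cnj (clock n j)) \<in> U_fin n"
    by (rule monomial_U_fin[of _ id]; simp add: clock_def)+
  moreover have "monomial_mat (reflect n) (\<lambda>j. 1) \<in> U_fin n"
    by (rule monomial_U_fin[of _ "reflect n"]) (auto simp: reflect_def)
  moreover have "monomial_mat (shift n) (\<lambda>j. 1) \<in> U_fin n"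
    by (rule monomial_U_fin[of _ "unshift n"]) (simp_all, simp add: shift_def)
  moreover have "monomial_mat (unshift n) (\<lambda>j. 1) \<in> U_fin n"
    by (rule monomial_U_fin[of _ "shift n"]) (simp_all, simp add: unshift_def)
  ultimately show ?thesis by (cases x rule: letter_gen_cases) simp_all
qed

lemma corner_monomial_id: "corner N (monomial_mat id g) = mat_diag N g"
  by (rule eq_matI) (auto simp: corner_def monomial_mat_def mat_diag_def)

lemma op_norm_diagonal_minus_one:
  assumes g: "\<And>j. cmod (g j) = 1" "\<And>j. n \<le> j \<Longrightarrow> g j = 1" and C: "\<And>j. cmod (g j - 1) \<le> C"
  shows "op_norm (mat_diff (monomial_mat id g) mat_one) \<le> C"
proof -
  have C0: "0 \<le> C" using C[of 0] norm_ge_zero order_trans by blast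
  have "monomial_mat id g \<in> U_fin n" by (rule monomial_U_fin[of _ id]) (use g in auto)
  moreover have "opbound n (mat_diag n g - 1\<^sub>m n) C"
  proof (rule diagonalized_opbound[OF unitary_mat_one])
    have "mat_diag n g - 1\<^sub>m n = mat_diag n (\<lambda>j. g j - 1)"
      by (rule eq_matI) (auto simp: mat_diag_def)
    then show "(mat_diag n g - 1\<^sub>m n) * 1\<^sub>m n = 1\<^sub>m n * mat_diag n (\<lambda>j. g j - 1)"
      by (simp add: right_mult_one_mat[OF mat_diag_carrier] left_mult_one_mat[OF mat_diag_carrier])
  qed (use C C0 in auto)
  ultimately show ?thesis
    using C0 by (subst op_norm_le_iff[of _ n]) (auto simp: U_fin_one corner_monomial_id)
qed

lemma finite_sym_relators:
  fixes R :: "('g::finite) word set"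
  assumes "finite R"
  shows "finite (sym_relators R)"
proof -
  have "x \<in> range Gen \<union> range Inv" for x :: "'g letter" by (cases x) auto
  then have "finite (UNIV :: 'g letter set)"
    by (intro finite_subset[of UNIV "range Gen \<union> range Inv"]) (blast, simp)
  then show ?thesis using assms by (simp add: sym_relators_def)
qed

lemma op_norm_le_deviation:
  assumes "finite R" "r \<in> sym_relators R"
  shows "op_norm (mat_diff (word_eval \<sigma> r) mat_one) \<le> deviation R \<sigma>"
  unfolding deviation_def using finite_sym_relators[OF assms(1)] assms(2) by (intro Max_ge) auto

lemma deviation_le:
  assumes "finite R" "\<And>r. r \<in> sym_relators R \<Longrightarrow> op_norm (mat_diff (word_eval \<sigma> r) mat_one) \<le> C"
  shows "deviation R \<sigma> \<le> C"
  unfolding deviation_def using finite_sym_relators[OF assms(1)] assms(2)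
  by (intro Max.boundedI) (auto simp: sym_relators_def)

lemma finite_Gamma_relators: "finite Gamma_relators"
  by (simp add: Gamma_relators_def)

lemma cmod_cis_minus_one: "cmod (cis x - 1) \<le> \<bar>x\<bar>"
proof -
  have "cmod (cis x - 1) = 2 * \<bar>sin (x / 2)\<bar>"
    using dist_exp_i_1[of x] by (simp add: dist_norm cis_conv_exp)
  then show ?thesis using abs_sin_x_le_abs_x[of "x / 2"] by simp
qed

lemma voiculescu_rep_deviation: "deviation Gamma_relators (voiculescu_rep n) \<le> 2 * pi / n"
proof (rule deviation_le[OF finite_Gamma_relators])
  fix r assume r: "r \<in> sym_relators Gamma_relators"
  let ?\<sigma> = "voiculescu_rep n"
  define g where "g = (\<lambda>j. if j < n then cis (2 * pi / n) else 1)"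
  have compose: "shift n \<circ> unshift n = id" "unshift n \<circ> shift n = id" "reflect n \<circ> reflect n = id" by auto
  have relators: "word_eval ?\<sigma> [x, letter_inv x] = mat_one" for x
    by (cases x rule: letter_gen_cases)
      (simp_all add: word_eval_def mat_one_monomial mat_mult_monomial compose)
  have bb: "word_eval ?\<sigma> [Gen gen_b, Gen gen_b] = mat_one"
    by (simp add: word_eval_def mat_one_monomial mat_mult_monomial compose)
  have abab: "word_eval ?\<sigma> [Gen gen_a, Gen gen_b, Gen gen_a, Gen gen_b] = mat_one"
    by (simp add: word_eval_def mat_one_monomial mat_mult_monomial compose clock_reflect)
  have "clock n j * cnj (clock n (unshift n j)) = g j" for j
  proof -
    have "clock n j = g j * clock n (unshift n j)"
    proof -
      have "unshift n j < n \<longleftrightarrow> j < n" by (auto simp: unshift_def)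
      then show ?thesis using clock_shift[of n "unshift n j"] by (simp add: g_def)
    qed
    then show ?thesis by (metis mult.assoc clock_cnj(1) mult.right_neutral)
  qed
  then have acac: "word_eval ?\<sigma> [Gen gen_a, Gen gen_c, Inv gen_a, Inv gen_c] = monomial_mat id g"
    by (simp add: word_eval_def mat_one_monomial mat_mult_monomial compose o_def) (simp add: id_def)
  have "op_norm (mat_diff (monomial_mat id g) mat_one) \<le> 2 * pi / n"
    by (rule op_norm_diagonal_minus_one[of _ n]) (use cmod_cis_minus_one[of "2 * pi / n"] in \<open>auto simp: g_def\<close>)
  moreover have "op_norm (mat_diff mat_one mat_one) \<le> 2 * pi / n"
    using op_norm_diagonal_minus_one[of "\<lambda>j. 1" n "2 * pi / n"] by (simp add: mat_one_monomial)
  ultimately show "op_norm (mat_diff (word_eval ?\<sigma> r) mat_one) \<le> 2 * pi / n"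
    using r relators bb abab acac by (auto simp: sym_relators_def Gamma_relators_def)
qed

lemma voiculescu_rep_bott:
  assumes n: "5 \<le> n" "n \<le> N"
  shows "bott (corner N (voiculescu_rep n (Gen gen_a))) (corner N (voiculescu_rep n (Gen gen_c))) = 1"
proof -
  let ?a = "voiculescu_rep n (Gen gen_a)" and ?c = "voiculescu_rep n (Gen gen_c)"
  let ?g = "\<lambda>j. if j < n then cis (2 * pi / n) else 1"
  have U: "?a \<in> U_fin N" "?c \<in> U_fin N" by (rule U_fin_mono[OF voiculescu_rep_U_fin n(2)])+
  have g: "monomial_mat id ?g \<in> U_fin N" by (rule monomial_U_fin[of _ id]) (use n in auto)
  have "mat_mult ?a ?c = mat_mult (mat_mult ?c ?a) (monomial_mat id ?g)"
    by (simp add: mat_mult_monomial clock_shift mult.commute)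
  then have "corner N ?a * corner N ?c = corner N ?c * corner N ?a * mat_diag N ?g"
    using U g by (metis (no_types, lifting) corner_monomial_id corner_mult one_off_corner_mult U_fin_iff)
  then show ?thesis
    using U n by (intro bott_eq_1[of N _ _ n]) (auto simp: U_fin_iff)
qed

text \<open>The \<open>n\<close> equations are the vanishing of the first \<open>n\<close> coordinates.\<close>

lemma near_one_off_U_fin:
  assumes u: "u \<in> U_fin n" and n: "n \<le> N"
  shows "near_one_off N (corner N u) n 0"
proof (rule rank_le_near_one_off)
  show "rank_le N (corner N u - 1\<^sub>m N) n"
    unfolding rank_le_def
  proof (intro exI[of _ "unit_vec N ` {..<n}"] conjI ballI impI)
    show "card (unit_vec N ` {..<n} :: complex vec set) \<le> n"
      using card_image_le[of "{..<n}" "unit_vec N :: nat \<Rightarrow> complex vec"] by simp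
    fix v :: "complex vec" assume v: "v \<in> carrier_vec N" "\<forall>f\<in>unit_vec N ` {..<n}. f \<bullet> v = 0"
    have v0: "v $ j = 0" if "j < n" for j using v that n by auto
    show "(corner N u - 1\<^sub>m N) *\<^sub>v v = 0\<^sub>v N"
    proof (rule eq_vecI)
      fix i assume "i < dim_vec (0\<^sub>v N :: complex vec)"
      then have i: "i < N" by simp
      have "((corner N u - 1\<^sub>m N) *\<^sub>v v) $ i = (\<Sum>j<N. (corner N u - 1\<^sub>m N) $$ (i, j) * v $ j)"
        using v i by (intro index_mult_mat_vec_sum[of _ N N]) auto
      also have "\<dots> = 0"
      proof (rule sum.neutral, rule ballI)
        fix j assume j: "j \<in> {..<N}"
        show "(corner N u - 1\<^sub>m N) $$ (i, j) * v $ j = 0"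
        proof (cases "j < n")
          case True
          then show ?thesis using v0 by simp
        next
          case False
          then have "u i j = mat_one i j" using u by (auto simp: U_fin_def)
          then show ?thesis using i j by (simp add: corner_def mat_one_def)
        qed
      qed
      finally show "((corner N u - 1\<^sub>m N) *\<^sub>v v) $ i = 0\<^sub>v N $ i" using i by simp
    qed (simp add: corner_def)
  qed auto
qed simp

section \<open>The obstruction along a path of almost representations\<close>

lemma word_eval_U_fin:
  assumes "\<forall>x. \<sigma> x \<in> U_fin N"
  shows "word_eval \<sigma> w \<in> U_fin N"
  using assms by (induction w) (auto simp: word_eval_def U_fin_one intro: U_fin_mult)

lemma corner_word_eval_Cons:
  assumes "\<forall>x. \<sigma> x \<in> U_fin N"
  shows "corner N (word_eval \<sigma> (x # w)) = corner N (\<sigma> x) * corner N (word_eval \<sigma> w)"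
  using word_eval_U_fin[OF assms, of w] assms
  by (simp add: word_eval_def corner_mult U_fin_iff)

lemma corner_word_eval_Nil: "corner N (word_eval \<sigma> []) = 1\<^sub>m N"
  by (simp add: word_eval_def)

lemma opbound_relator:
  assumes \<sigma>: "\<forall>x. \<sigma> x \<in> U_fin N" and dev: "deviation R \<sigma> \<le> \<delta>" "0 \<le> \<delta>"
    and R: "finite R" "r \<in> sym_relators R"
  shows "opbound N (corner N (word_eval \<sigma> r) - 1\<^sub>m N) \<delta>"
proof -
  have "op_norm (mat_diff (word_eval \<sigma> r) mat_one) \<le> \<delta>"
    using op_norm_le_deviation[OF R, of \<sigma>] dev(1) by (rule order_trans)
  then show ?thesis
    using op_norm_le_iff[OF word_eval_U_fin[OF \<sigma>, of r] U_fin_one dev(2)] by simp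
qed

lemma Gamma_almost_relations:
  fixes \<sigma> :: "gen letter \<Rightarrow> cmat"
  assumes \<sigma>: "\<forall>x. \<sigma> x \<in> U_fin N" and dev: "deviation Gamma_relators \<sigma> \<le> \<delta>" "0 \<le> \<delta>"
  defines "a \<equiv> corner N (\<sigma> (Gen gen_a))" and "b \<equiv> corner N (\<sigma> (Gen gen_b))" and "c \<equiv> corner N (\<sigma> (Gen gen_c))"
  shows "opbound N (b * b - 1\<^sub>m N) \<delta>" "opbound N ((a * b) * (a * b) - 1\<^sub>m N) \<delta>"
    "opbound N (a * c - c * a) (3 * \<delta>)"
proof -
  note rel = opbound_relator[OF \<sigma> dev finite_Gamma_relators]
  note ev = corner_word_eval_Cons[OF \<sigma>] corner_word_eval_Nil
  have mem: "[Gen gen_b, Gen gen_b] \<in> sym_relators Gamma_relators"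
    "[Gen gen_a, Gen gen_b, Gen gen_a, Gen gen_b] \<in> sym_relators Gamma_relators"
    "[Gen gen_a, Gen gen_c, Inv gen_a, Inv gen_c] \<in> sym_relators Gamma_relators"
    "[Inv gen_a, Gen gen_a] \<in> sym_relators Gamma_relators"
    "[Inv gen_c, Gen gen_c] \<in> sym_relators Gamma_relators"
    by (auto simp: sym_relators_def Gamma_relators_def intro: range_eqI[of _ _ "Inv _"])
  show "opbound N (b * b - 1\<^sub>m N) \<delta>"
    using rel[OF mem(1)] by (simp add: ev b_def)
  show "opbound N ((a * b) * (a * b) - 1\<^sub>m N) \<delta>"
    using rel[OF mem(2)] by (simp add: ev a_def b_def square_mat_assoc[of _ N])
  have u: "unitary_mat N (corner N (\<sigma> x))" for x using \<sigma> by (simp add: U_fin_iff)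
  show "opbound N (a * c - c * a) (3 * \<delta>)"
    unfolding a_def c_def
    by (rule opbound_commutator[OF u u u[of "Inv gen_a"] u[of "Inv gen_c"]])
      (use rel[OF mem(3)] rel[OF mem(4)] rel[OF mem(5)] dev in \<open>simp_all add: ev\<close>)
qed

text \<open>The Bott index is nontrivial, and the reflections \<open>b\<close> and \<open>ab\<close> have at most \<open>n\<close> eigenvalues
  near \<open>-1\<close>. This is preserved along paths of almost representations, but for fixed \<open>n\<close> it excludes a
  very small deviation.\<close>

definition obstructed :: "nat \<Rightarrow> nat \<Rightarrow> (gen letter \<Rightarrow> cmat) \<Rightarrow> bool" where
  "obstructed N n \<sigma> \<longleftrightarrow>
     bott (corner N (\<sigma> (Gen gen_a))) (corner N (\<sigma> (Gen gen_c))) \<noteq> 0 \<and>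
     near_one_off N (corner N (\<sigma> (Gen gen_b))) n (1/2) \<and>
     near_one_off N (corner N (\<sigma> (Gen gen_a)) * corner N (\<sigma> (Gen gen_b))) n (1/2)"

lemma obstructed_stable:
  assumes \<sigma>: "\<forall>x. \<sigma> x \<in> U_fin N" and dev: "deviation Gamma_relators \<sigma> \<le> 1/100"
    and \<sigma>': "\<forall>x. \<sigma>' x \<in> U_fin N" and dev': "deviation Gamma_relators \<sigma>' \<le> 1/100"
    and close: "\<And>x. op_norm (mat_diff (\<sigma> x) (\<sigma>' x)) \<le> 1/100"
    and obs: "obstructed N n \<sigma>"
  shows "obstructed N n \<sigma>'"
proof -
  have u: "unitary_mat N (corner N (\<sigma> x))" "unitary_mat N (corner N (\<sigma>' x))" for x
    using \<sigma> \<sigma>' by (simp_all add: U_fin_iff)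
  have cl: "opbound N (corner N (\<sigma> x) - corner N (\<sigma>' x)) (1/100)" for x
    using close[of x] op_norm_le_iff[of "\<sigma> x" N "\<sigma>' x" "1/100"] \<sigma> \<sigma>' by simp
  have cl': "opbound N (corner N (\<sigma>' x) - corner N (\<sigma> x)) (1/100)" for x
    by (rule opbound_minus_commute[OF cl]) simp_all
  have "0 \<le> (1 / 100 :: real)" by simp
  note rel = Gamma_almost_relations[OF \<sigma> dev this] and rel' = Gamma_almost_relations[OF \<sigma>' dev' this]
  have "bott (corner N (\<sigma> (Gen gen_a))) (corner N (\<sigma> (Gen gen_c))) =
      bott (corner N (\<sigma>' (Gen gen_a))) (corner N (\<sigma>' (Gen gen_c)))"
    by (rule bott_stable[OF u(1) u(2) u(1) u(2) cl cl _ rel(3)]) auto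
  moreover have "near_one_off N (corner N (\<sigma>' (Gen gen_b))) n (1/2)"
    by (rule near_one_off_stable[OF u(2) u(1) rel'(1)])
      (use obs opbound_mono[OF cl'] in \<open>auto simp: obstructed_def\<close>)
  moreover have "near_one_off N (corner N (\<sigma>' (Gen gen_a)) * corner N (\<sigma>' (Gen gen_b))) n (1/2)"
  proof (rule near_one_off_stable[OF unitary_mat_mult[OF u(2) u(2)] unitary_mat_mult[OF u(1) u(1)] rel'(2)])
    have "opbound N (corner N (\<sigma>' (Gen gen_a)) * corner N (\<sigma>' (Gen gen_b)) -
        corner N (\<sigma> (Gen gen_a)) * corner N (\<sigma> (Gen gen_b))) (2 * (1/100))"
      by (rule product_perturbation[OF _ u(1) _ _ opbound_unitary[OF u(2)] cl' cl']) simp_all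
    then show "opbound N (corner N (\<sigma>' (Gen gen_a)) * corner N (\<sigma>' (Gen gen_b)) -
        corner N (\<sigma> (Gen gen_a)) * corner N (\<sigma> (Gen gen_b))) (1/4)"
      by (rule opbound_mono) simp
  qed (use obs in \<open>auto simp: obstructed_def\<close>)
  ultimately show ?thesis using obs by (simp add: obstructed_def)
qed

lemma obstructed_voiculescu_rep:
  assumes n: "5 \<le> n" "n \<le> N"
  shows "obstructed N n (voiculescu_rep n)"
proof -
  note U = voiculescu_rep_U_fin[of n] and V = U_fin_mono[OF voiculescu_rep_U_fin n(2)]
  have mono: "near_one_off N A n 0 \<Longrightarrow> A \<in> carrier_mat N N \<Longrightarrow> near_one_off N A n (1/2)" for A
    using near_one_off_perturb[OF _ _ _ opbound_self_minus[of A N "1/2"], of n 0] by simp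
  have "corner N (voiculescu_rep n (Gen gen_a)) * corner N (voiculescu_rep n (Gen gen_b)) =
      corner N (mat_mult (voiculescu_rep n (Gen gen_a)) (voiculescu_rep n (Gen gen_b)))"
    by (rule corner_mult[symmetric]) (use V U_fin_iff in blast)+
  then have "near_one_off N (corner N (voiculescu_rep n (Gen gen_a)) * corner N (voiculescu_rep n (Gen gen_b))) n (1/2)"
    using mono[OF near_one_off_U_fin[OF U_fin_mult[OF U U] n(2)] corner_carrier] by (simp only:)
  moreover have "near_one_off N (corner N (voiculescu_rep n (Gen gen_b))) n (1/2)"
    by (rule mono[OF near_one_off_U_fin[OF U n(2)] corner_carrier])
  moreover have "bott (corner N (voiculescu_rep n (Gen gen_a))) (corner N (voiculescu_rep n (Gen gen_c))) \<noteq> 0"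
    unfolding voiculescu_rep_bott[OF n] by simp
  ultimately show ?thesis unfolding obstructed_def by blast
qed

text \<open>With deviation \<open>\<eta> = 1/(112 n)\<close> the commutator is bounded by \<open>3 \<eta>\<close>, and replacing
  \<open>a\<close> by a product of exact reflections adds \<open>4 \<eta>\<close>. The sum is \<open>1/(16 n)\<close>, and
  \<open>(1 + 1/(16 n))\<^bsup>4n\<^esup> \<le> e\<^bsup>1/4\<^esup> < 2\<close>.\<close>

lemma not_obstructed_small_deviation:
  assumes \<sigma>: "\<forall>x. \<sigma> x \<in> U_fin N" and dev: "deviation Gamma_relators \<sigma> \<le> 1 / (112 * real n)" and n: "0 < n"
  shows "\<not> obstructed N n \<sigma>"
proof
  assume obs: "obstructed N n \<sigma>"
  let ?\<eta> = "1 / (112 * real n)"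
  have u: "unitary_mat N (corner N (\<sigma> x))" for x using \<sigma> by (simp add: U_fin_iff)
  have "0 \<le> ?\<eta>" by simp
  note rel = Gamma_almost_relations[OF \<sigma> dev this]
  have x: "4 * ?\<eta> + 3 * ?\<eta> = 1 / (16 * real n)" by (simp add: field_simps)
  have "(1 + 1 / (16 * real n)) ^ (4 * n) \<le> exp (1 / (16 * real n)) ^ (4 * n)"
  proof (rule power_mono)
    show "1 + 1 / (16 * real n) \<le> exp (1 / (16 * real n))" by (rule exp_ge_add_one_self)
    show "0 \<le> 1 + 1 / (16 * real n)" using n by (simp add: field_simps)
  qed
  also have "\<dots> = exp (real (4 * n) * (1 / (16 * real n)))" by (rule exp_of_nat_mult[symmetric])
  also have "\<dots> = exp (1 / 4)" using n by simp
  also have "\<dots> < exp (1 / 2)" by simp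
  also have "\<dots> \<le> 2" by (rule exp_half_le2)
  finally have "(1 + (4 * ?\<eta> + 3 * ?\<eta>)) ^ (4 * n) < 2" unfolding x .
  moreover have "4 * ?\<eta> + 3 * ?\<eta> < 1" unfolding x using n by (simp add: field_simps)
  ultimately have small: "(1 + (4 * ?\<eta> + 3 * ?\<eta>)) ^ (4 * n) < 2" "4 * ?\<eta> + 3 * ?\<eta> < 1" by blast+
  have "bott (corner N (\<sigma> (Gen gen_a))) (corner N (\<sigma> (Gen gen_c))) = 0"
    by (rule bott_eq_0_of_reflections[OF u u u rel _ _ _ _ small(2,1)])
      (use obs in \<open>auto simp: obstructed_def\<close>)
  then show False using obs by (simp add: obstructed_def)
qed

lemma eventually_all_U_fin:
  fixes \<sigma> :: "gen letter \<Rightarrow> cmat"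
  assumes "\<And>x. \<sigma> x \<in> U_inf"
  shows "\<exists>M. \<forall>N\<ge>M. \<forall>x. \<sigma> x \<in> U_fin N"
proof -
  have "\<forall>x. \<exists>m. \<sigma> x \<in> U_fin m" using assms by (simp add: U_inf_def)
  then obtain m where m: "\<And>x. \<sigma> x \<in> U_fin (m x)" by metis
  let ?L = "{Gen gen_a, Inv gen_a, Gen gen_b, Inv gen_b, Gen gen_c, Inv gen_c}"
  have "m x \<le> sum m ?L" for x
  proof (rule member_le_sum)
    show "x \<in> ?L" by (cases x rule: letter_gen_cases) simp_all
  qed simp_all
  then have "\<sigma> x \<in> U_fin N" if "sum m ?L \<le> N" for N x
    using U_fin_mono[OF m[of x], of N] that le_trans by blast
  then show ?thesis by blast
qed

lemma norm_continuous_path_near: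
  assumes "norm_continuous_path u" "0 \<le> s" "0 < e"
  shows "\<exists>d>0. \<forall>t\<ge>0. t \<noteq> s \<longrightarrow> dist t s < d \<longrightarrow> op_norm (mat_diff (u t) (u s)) < e"
proof -
  have "((\<lambda>t. op_norm (mat_diff (u t) (u s))) \<longlongrightarrow> 0) (at s within {0..})"
    using assms by (simp add: norm_continuous_path_def)
  then have "\<forall>\<^sub>F t in at s within {0..}. op_norm (mat_diff (u t) (u s)) < e"
    by (rule order_tendstoD) (rule assms)
  then show ?thesis by (auto simp: eventually_at)
qed

text \<open>Being obstructed alike in all sufficiently large sizes is an equivalence relation
  between times, and it relates nearby times: two almost representations are contained in a common
  \<open>U_fin N\<close>, where they can be compared. Since the half-line is connected, all times are related. No
  size needs to serve for more than two times at once.\<close>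

lemma obstructed_along_path:
  assumes U: "\<And>t x. 0 \<le> t \<Longrightarrow> \<tau> t x \<in> U_inf"
    and cont: "\<And>x. norm_continuous_path (\<lambda>t. \<tau> t x)"
    and dev: "\<And>t. 0 \<le> t \<Longrightarrow> deviation Gamma_relators (\<tau> t) \<le> 1/100"
    and T: "0 \<le> T"
  shows "\<exists>M. \<forall>N\<ge>M. obstructed N n (\<tau> 0) \<longleftrightarrow> obstructed N n (\<tau> T)"
proof (rule connected_equivalence_relation[where S = "{0..}" and R = "\<lambda>s t. \<exists>M. \<forall>N\<ge>M. obstructed N n (\<tau> s) \<longleftrightarrow> obstructed N n (\<tau> t)"])
  fix r s t assume "\<exists>M. \<forall>N\<ge>M. obstructed N n (\<tau> r) = obstructed N n (\<tau> s)"
    "\<exists>M. \<forall>N\<ge>M. obstructed N n (\<tau> s) = obstructed N n (\<tau> t)"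
  then obtain M M' where "\<forall>N\<ge>M. obstructed N n (\<tau> r) = obstructed N n (\<tau> s)"
    "\<forall>N\<ge>M'. obstructed N n (\<tau> s) = obstructed N n (\<tau> t)" by blast
  then show "\<exists>M. \<forall>N\<ge>M. obstructed N n (\<tau> r) = obstructed N n (\<tau> t)"
    by (intro exI[of _ "max M M'"]) simp
next
  fix s t assume "\<exists>M. \<forall>N\<ge>M. obstructed N n (\<tau> s) = obstructed N n (\<tau> t)"
  then show "\<exists>M. \<forall>N\<ge>M. obstructed N n (\<tau> t) = obstructed N n (\<tau> s)" by blast
next
  fix s :: real assume "s \<in> {0..}"
  then have s: "0 \<le> s" by simp
  have "\<forall>x. \<exists>d>0. \<forall>t\<ge>0. t \<noteq> s \<longrightarrow> dist t s < d \<longrightarrow> op_norm (mat_diff (\<tau> t x) (\<tau> s x)) < 1/100"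
    using norm_continuous_path_near[OF cont s, of "1/100"] by simp
  then obtain d where d: "\<And>x. 0 < d x"
      "\<And>x t. 0 \<le> t \<Longrightarrow> t \<noteq> s \<Longrightarrow> dist t s < d x \<Longrightarrow> op_norm (mat_diff (\<tau> t x) (\<tau> s x)) < 1/100"
    by (auto dest!: choice)
  define D where "D = Min (d ` {Gen gen_a, Inv gen_a, Gen gen_b, Inv gen_b, Gen gen_c, Inv gen_c})"
  have D: "0 < D" unfolding D_def using d(1) by simp
  have Dx: "D \<le> d x" for x
    unfolding D_def by (cases x rule: letter_gen_cases) (simp_all add: Min_le_iff)
  have near: "\<exists>M. \<forall>N\<ge>M. obstructed N n (\<tau> s) = obstructed N n (\<tau> t)" if t: "t \<in> {0..} \<inter> ball s D" for t
  proof (cases "t = s")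
    case False
    have t0: "0 \<le> t" and ts: "dist t s < d x" for x
      using t Dx[of x] by (auto simp: dist_commute)
    obtain M where M: "\<And>N. M \<le> N \<Longrightarrow> \<forall>x. \<tau> s x \<in> U_fin N"
      using eventually_all_U_fin[of "\<tau> s"] U[OF s] by blast
    obtain M' where M': "\<And>N. M' \<le> N \<Longrightarrow> \<forall>x. \<tau> t x \<in> U_fin N"
      using eventually_all_U_fin[of "\<tau> t"] U[OF t0] by blast
    have "obstructed N n (\<tau> s) = obstructed N n (\<tau> t)" if N: "max M M' \<le> N" for N
    proof -
      have Us: "\<forall>x. \<tau> s x \<in> U_fin N" and Ut: "\<forall>x. \<tau> t x \<in> U_fin N" using M M' N by auto
      have close: "op_norm (mat_diff (\<tau> t x) (\<tau> s x)) \<le> 1/100" for x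
        using d(2)[OF t0 False ts] by (rule less_imp_le)
      have close': "op_norm (mat_diff (\<tau> s x) (\<tau> t x)) \<le> 1/100" for x
        using close[of x] op_norm_le_iff[of "\<tau> s x" N "\<tau> t x" "1/100"]
          op_norm_le_iff[of "\<tau> t x" N "\<tau> s x" "1/100"] Us Ut
          opbound_minus_commute[of N "corner N (\<tau> t x)" "corner N (\<tau> s x)"] by simp
      show ?thesis
        using obstructed_stable[OF Us dev[OF s] Ut dev[OF t0] close']
          obstructed_stable[OF Ut dev[OF t0] Us dev[OF s] close] by blast
    qed
    then show ?thesis by blast
  qed auto
  show "\<exists>A. openin (top_of_set {0..}) A \<and> s \<in> A \<and> (\<forall>t\<in>A. \<exists>M. \<forall>N\<ge>M. obstructed N n (\<tau> s) = obstructed N n (\<tau> t))"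
    using near s D by (intro exI[of _ "{0..} \<inter> ball s D"]) (auto intro: openin_open_Int)
qed (use T in simp_all)

theorem theorem9: "\<not> AGA Gamma_relators"
proof
  assume "AGA Gamma_relators"
  then obtain \<delta> :: "real \<Rightarrow> real" where \<delta>: "(\<delta> \<longlongrightarrow> 0) (at_right 0)"
    and AGA: "\<And>\<epsilon> \<sigma>. 0 < \<epsilon> \<Longrightarrow> \<sigma> \<in> almost_reps Gamma_relators \<epsilon> \<Longrightarrow>
      \<exists>\<tau>\<in>asym_reps Gamma_relators. \<tau> 0 = \<sigma> \<and> (\<forall>t\<ge>0. deviation Gamma_relators (\<tau> t) \<le> \<delta> \<epsilon>)"
    unfolding AGA_def by blast
  have "\<forall>\<^sub>F \<epsilon> in at_right 0. \<delta> \<epsilon> < 1/100" by (rule order_tendstoD(2)[OF \<delta>]) simp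
  then obtain e where e: "0 < e" "\<And>\<epsilon>. 0 < \<epsilon> \<Longrightarrow> \<epsilon> < e \<Longrightarrow> \<delta> \<epsilon> < 1/100"
    unfolding eventually_at_right_field by blast
  \<comment> \<open>The size \<open>n\<close> is chosen from the tolerance \<open>1/100\<close>, under which the invariants are stable for
    every \<open>n\<close>. Only then does the path come in, so its deviation may be compared with \<open>1/n\<close>.\<close>
  obtain k :: nat where k: "2 * pi / e < k" using reals_Archimedean2 by blast
  define n where "n = max 5 k"
  have n: "5 \<le> n" by (simp add: n_def)
  have "2 * pi / e < n" using k by (simp add: n_def)
  then have small: "2 * pi / n < e" using e(1) n by (simp add: field_simps)
  have pos: "0 < 2 * pi / n" using n by simp
  have "voiculescu_rep n \<in> almost_reps Gamma_relators (2 * pi / n)"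
    using voiculescu_rep_U_fin voiculescu_rep_deviation by (auto simp: almost_reps_def U_inf_def)
  then obtain \<tau> where \<tau>: "\<tau> \<in> asym_reps Gamma_relators" "\<tau> 0 = voiculescu_rep n"
      "\<And>t. 0 \<le> t \<Longrightarrow> deviation Gamma_relators (\<tau> t) \<le> \<delta> (2 * pi / n)"
    using AGA[OF pos] by blast
  have U: "\<tau> t x \<in> U_inf" if "0 \<le> t" for t x using \<tau>(1) that by (simp add: asym_reps_def)
  have dev: "deviation Gamma_relators (\<tau> t) \<le> 1/100" if "0 \<le> t" for t
    using \<tau>(3)[OF that] e(2)[OF pos small] by simp
  have cont: "norm_continuous_path (\<lambda>t. \<tau> t x)" for x using \<tau>(1) by (simp add: asym_reps_def)
  have "((\<lambda>t. deviation Gamma_relators (\<tau> t)) \<longlongrightarrow> 0) at_top"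
    using \<tau>(1) by (simp add: asym_reps_def)
  then have "\<forall>\<^sub>F t in at_top. deviation Gamma_relators (\<tau> t) < 1 / (112 * real n)"
    by (rule order_tendstoD) (use n in simp)
  then obtain T0 where T0: "\<And>t. T0 \<le> t \<Longrightarrow> deviation Gamma_relators (\<tau> t) < 1 / (112 * real n)"
    unfolding eventually_at_top_linorder by blast
  define T where "T = max 0 T0"
  have T: "0 \<le> T" "deviation Gamma_relators (\<tau> T) < 1 / (112 * real n)" using T0[of T] by (simp_all add: T_def)
  obtain M where M: "\<And>N. M \<le> N \<Longrightarrow> obstructed N n (\<tau> 0) \<longleftrightarrow> obstructed N n (\<tau> T)"
    using obstructed_along_path[OF U cont dev T(1)] by blast
  obtain M' where M': "\<And>N. M' \<le> N \<Longrightarrow> \<forall>x. \<tau> T x \<in> U_fin N"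
    using eventually_all_U_fin[of "\<tau> T"] U[OF T(1)] by blast
  define N where "N = max n (max M M')"
  have "obstructed N n (\<tau> T)"
    using M[of N] obstructed_voiculescu_rep[OF n, of N] by (simp add: N_def \<tau>(2))
  moreover have "\<not> obstructed N n (\<tau> T)"
  proof (rule not_obstructed_small_deviation)
    show "\<forall>x. \<tau> T x \<in> U_fin N" by (rule M') (simp add: N_def)
    show "deviation Gamma_relators (\<tau> T) \<le> 1 / (112 * real n)" using T(2) by simp
  qed (use n in simp)
  ultimately show False by simp
qed

end
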